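(* Let $\mathcal{A}\subset\mathbb{P}^n$ be a hyperplane arrangement. For any general linear form $\ell\in S$, the minimal primary decomposition of the general residual $r_{\mathcal{A}}$ with respect to $\ell$ is $$r_{\mathcal{A}}=\bigcap_{P\in S(\mathcal{A})}(\ell_P, I_P^{t_P-1}),$$ where $t_P$ denotes the number of hyperplanes of $\mathcal{A}$ that contain $P$. In particular, the radical of $r_{\mathcal{A}}$ is determined by the intersection lattice of $\mathcal{A}$ as $$\sqrt{r_{\mathcal{A}}}=I_{S(\mathcal{A})},\qquad\text{where } I_{S(\mathcal{A})}=\bigcap_{P\in S(\mathcal{A})}I_P.$$
   Context: $K$ is a field of characteristic zero, $n\ge2$, $S=K[x_0,\dots,x_n]$ with the standard grading. A hyperplane arrangement $\mathcal{A}\subset\mathbb{P}^n$ is a finite nonempty set of distinct hyperplanes, and $f_{\mathcal{A}}$ is the product of linear forms defining them. $\mathrm{Jac}(f_{\mathcal{A}})\subset S$ is the ideal generated by the first partial derivatives of $f_{\mathcal{A}}$. For a linear form $\ell=\sum a_ix_i$, put $\frac{\partial f}{\partial\ell}=\sum_i a_i\frac{\partial f}{\partial x_i}$ and $\ell^\vee=(a_0:\dots:a_n)\in\mathbb{P}^n$. For a general $\ell$ (in a suitable nonempty Zariski-open subset of $[S]_1$ depending on $\mathcal{A}$), the general residual of $\mathcal{A}$ with respect to $\ell$ is $r_{\mathcal{A}}=(f_{\mathcal{A}},\frac{\partial f_{\mathcal{A}}}{\partial\ell}):\mathrm{Jac}(f_{\mathcal{A}})$. $S(\mathcal{A})=\{H\cap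 H' : H\neq H'\in\mathcal{A}\}$ is a set of codimension two linear subspaces; for $P\in S(\mathcal{A})$, $I_P$ is its homogeneous ideal and $\ell_P$ is a linear form defining the hyperplane spanned by $P$ and $\ell^\vee$. *)

theory Defs
  imports "HOL-Library.Poly_Mapping" "HOL-Analysis.Cartesian_Space"
begin

section \<open>Ideals of a commutative ring\<close>

text \<open>An ideal is a submodule of the ring over itself: \<open>ideal.subspace I\<close> says that \<open>I\<close> is an
  ideal and \<open>ideal.span G\<close> is the ideal generated by \<open>G\<close>.\<close>

interpretation ideal: module "times :: 'r::comm_ring_1 \<Rightarrow> 'r \<Rightarrow> 'r"
  by standard (simp_all add: algebra_simps)

definition ideal_colon :: "'r::comm_ring_1 set \<Rightarrow> 'r set \<Rightarrow> 'r set" where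
  "ideal_colon I J = {p. \<forall>q\<in>J. p * q \<in> I}"

definition ideal_radical :: "'r::comm_ring_1 set \<Rightarrow> 'r set" where
  "ideal_radical I = {p. \<exists>k. p ^ k \<in> I}"

primrec ideal_power :: "'r::comm_ring_1 set \<Rightarrow> nat \<Rightarrow> 'r set" where
  "ideal_power I 0 = UNIV"
| "ideal_power I (Suc k) = ideal.span {p * q |p q. p \<in> I \<and> q \<in> ideal_power I k}"

definition primary_ideal :: "'r::comm_ring_1 set \<Rightarrow> bool" where
  "primary_ideal Q \<longleftrightarrow> ideal.subspace Q \<and> Q \<noteq> UNIV \<and>
     (\<forall>p q. p * q \<in> Q \<longrightarrow> p \<in> Q \<or> (\<exists>k. q ^ k \<in> Q))"

text \<open>The empty family is the minimal primary decomposition of the unit ideal.\<close>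

definition minimal_primary_decomposition ::
    "'r::comm_ring_1 set \<Rightarrow> 'i set \<Rightarrow> ('i \<Rightarrow> 'r set) \<Rightarrow> bool" where
  "minimal_primary_decomposition I J Q \<longleftrightarrow>
     finite J \<and> (\<forall>j\<in>J. primary_ideal (Q j)) \<and> I = (\<Inter>j\<in>J. Q j) \<and>
     inj_on (\<lambda>j. ideal_radical (Q j)) J \<and>
     (\<forall>j\<in>J. \<not> (\<Inter>i\<in>J - {j}. Q i) \<subseteq> Q j)"


section \<open>The polynomial ring\<close>

text \<open>The variables are indexed by a finite type \<open>'n\<close>; with \<open>CARD('n) = n + 1\<close> the type below is
  \<open>K[x_0, \<dots>, x_n]\<close>.\<close>

type_synonym ('a, 'n) mpoly = "('n \<Rightarrow>\<^sub>0 nat) \<Rightarrow>\<^sub>0 'a"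

definition peval :: "('a::comm_ring_1, 'n::finite) mpoly \<Rightarrow> 'a ^ 'n \<Rightarrow> 'a" where
  "peval p x = (\<Sum>m\<in>Poly_Mapping.keys p.
     Poly_Mapping.lookup p m * (\<Prod>i\<in>UNIV. (x $ i) ^ Poly_Mapping.lookup m i))"

text \<open>\<open>forms d\<close> is the homogeneous component of degree \<open>d\<close>, including \<open>0\<close>.\<close>

definition forms :: "nat \<Rightarrow> ('a::comm_ring_1, 'n::finite) mpoly set" where
  "forms d = {p. \<forall>m\<in>Poly_Mapping.keys p. (\<Sum>i\<in>UNIV. Poly_Mapping.lookup m i) = d}"

text \<open>Where the truncated subtraction \<open>m - single i 1\<close> is not the exponent of the derivative, the
  coefficient vanishes.\<close>

definition partial_deriv :: "'n::finite \<Rightarrow> ('a::comm_ring_1, 'n) mpoly \<Rightarrow> ('a, 'n) mpoly" where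
  "partial_deriv i p = (\<Sum>m\<in>Poly_Mapping.keys p.
     Poly_Mapping.single (m - Poly_Mapping.single i 1)
       (of_nat (Poly_Mapping.lookup m i) * Poly_Mapping.lookup p m))"

definition jacobian_ideal :: "('a::comm_ring_1, 'n::finite) mpoly \<Rightarrow> ('a, 'n) mpoly set" where
  "jacobian_ideal f = ideal.span (range (\<lambda>i. partial_deriv i f))"

text \<open>For a linear form \<open>\<ell> = \<Sum>\<^sub>i a\<^sub>i x\<^sub>i\<close>, the coefficient vector \<open>a\<close> is a representative of the
  projective point \<open>\<ell>\<^sup>\<or>\<close>.\<close>

definition dual_vec :: "('a::comm_ring_1, 'n::finite) mpoly \<Rightarrow> 'a ^ 'n" where
  "dual_vec l = (\<chi> i. Poly_Mapping.lookup l (Poly_Mapping.single i 1))"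

definition form_deriv ::
    "('a::comm_ring_1, 'n::finite) mpoly \<Rightarrow> ('a, 'n) mpoly \<Rightarrow> ('a, 'n) mpoly" where
  "form_deriv l f = (\<Sum>i\<in>UNIV. Poly_Mapping.single 0 (dual_vec l $ i) * partial_deriv i f)"

text \<open>Zariski-open subsets of the affine space of linear forms, with the coefficients as
  coordinates.\<close>

definition zariski_open_linear_forms :: "('a::comm_ring_1, 'n::finite) mpoly set \<Rightarrow> bool" where
  "zariski_open_linear_forms U \<longleftrightarrow>
     (\<exists>T :: ('a, 'n) mpoly set. U = {l \<in> forms 1. \<exists>F\<in>T. peval F (dual_vec l) \<noteq> 0})"


section \<open>Hyperplane arrangements in projective space\<close>

text \<open>A linear subspace of projective space is represented by its affine cone, a vector subspace
  of \<open>K\<^sup>n\<^sup>+\<^sup>1\<close>; intersections and inclusions are unaffected, and projective span becomes vector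
  space span.\<close>

definition proj_hyperplane :: "('a::field ^ 'n::finite) set \<Rightarrow> bool" where
  "proj_hyperplane H \<longleftrightarrow> vec.subspace H \<and> vec.dim H + 1 = CARD('n)"

definition hyperplane_arrangement :: "('a::field ^ 'n::finite) set set \<Rightarrow> bool" where
  "hyperplane_arrangement A \<longleftrightarrow> finite A \<and> A \<noteq> {} \<and> (\<forall>H\<in>A. proj_hyperplane H)"

definition defines_hyperplane :: "('a::field, 'n::finite) mpoly \<Rightarrow> ('a ^ 'n) set \<Rightarrow> bool" where
  "defines_hyperplane h H \<longleftrightarrow> h \<in> forms 1 \<and> h \<noteq> 0 \<and> H = {x. peval h x = 0}"

text \<open>\<open>h H\<close> is the chosen linear form defining \<open>H\<close>.\<close>

definition arrangement_poly ::
    "('a::field ^ 'n::finite) set set \<Rightarrow> (('a ^ 'n) set \<Rightarrow> ('a, 'n) mpoly) \<Rightarrow> ('a, 'n) mpoly" where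
  "arrangement_poly A h = (\<Prod>H\<in>A. h H)"

definition residual ::
    "('a::field, 'n::finite) mpoly \<Rightarrow> ('a, 'n) mpoly \<Rightarrow> ('a, 'n) mpoly set" where
  "residual f l = ideal_colon (ideal.span {f, form_deriv l f}) (jacobian_ideal f)"

definition codim2_flats :: "('a ^ 'n) set set \<Rightarrow> ('a ^ 'n) set set" where
  "codim2_flats A = {H \<inter> H' |H H'. H \<in> A \<and> H' \<in> A \<and> H \<noteq> H'}"

definition hyperplanes_through :: "('a ^ 'n) set set \<Rightarrow> ('a ^ 'n) set \<Rightarrow> nat" where
  "hyperplanes_through A P = card {H \<in> A. P \<subseteq> H}"

definition homogeneous_ideal :: "('a::field ^ 'n::finite) set \<Rightarrow> ('a, 'n) mpoly set" where
  "homogeneous_ideal P = ideal.span {p. (\<exists>d. p \<in> forms d) \<and> (\<forall>x\<in>P. peval p x = 0)}"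

definition dual_join :: "('a::field ^ 'n::finite) set \<Rightarrow> ('a, 'n) mpoly \<Rightarrow> ('a ^ 'n) set" where
  "dual_join P l = vec.span (insert (dual_vec l) P)"

end

theory Submission
  imports Defs "HOL-Computational_Algebra.Polynomial"
begin

text \<open>Let \<open>a = \<ell>\<^sup>\<or>\<close>. It suffices that \<open>f a \<noteq> 0\<close>, so that the defining forms can be scaled to \<open>g H\<close>
  with \<open>g H a = 1\<close>. Modulo \<open>g H\<close> a partial derivative of \<open>f = \<Prod> g H\<close> is \<open>\<partial>\<^sub>i (g H)\<close> times the
  cofactor of \<open>g H\<close>; cancelling cofactors, \<open>p\<close> lies in the residual iff for every \<open>i\<close> some
  polynomial \<open>u\<close> interpolates \<open>u \<equiv> \<partial>\<^sub>i (g H) p\<close> modulo all \<open>g H\<close>. The hyperplanes through \<open>P\<close> are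
  \<open>x - b y\<close> with \<open>y = \<ell>\<^sub>P\<close>, and solvability of their congruences amounts to
  \<open>p x \<in> (y, x\<^sup>t)\<close> with \<open>t = t\<^sub>P\<close>, that is, \<open>p\<close> in \<open>(y, x\<^sup>t\<^sup>-\<^sup>1)\<close>. Conversely, \<open>u\<close> is built by Newton
  interpolation, one hyperplane at a time; the divisibility needed at each step is tested at the
  flats of codimension two.\<close>

text \<open>As a simplification rule this loops against \<open>mult_ac\<close>.\<close>

declare ideal.scale_scale [simp del]

section \<open>Polynomials and polynomial functions\<close>

definition Var :: "'n \<Rightarrow> ('a::comm_ring_1, 'n::finite) mpoly" where
  "Var i = Poly_Mapping.single (Poly_Mapping.single i 1) 1"

abbreviation Const :: "'a::comm_ring_1 \<Rightarrow> ('a, 'n::finite) mpoly" where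
  "Const c \<equiv> Poly_Mapping.single 0 c"

lemma Const_mult: "Const (a * b) = Const a * Const b"
  by (simp add: mult_single)

lemma prod_Const: "(\<Prod>i\<in>I. Const (c i)) = Const (\<Prod>i\<in>I. c i)"
  by (induction I rule: infinite_finite_induct) (simp_all add: Const_mult)

lemma Var_power: "Var i ^ k = Poly_Mapping.single (Poly_Mapping.single i k) 1"
  by (induction k) (simp_all add: Var_def mult_single single_add[symmetric])

lemma prod_single_one:
  "(\<Prod>i\<in>I. Poly_Mapping.single (g i) (1::'a::comm_ring_1)) = Poly_Mapping.single (\<Sum>i\<in>I. g i) 1"
  by (induction I rule: infinite_finite_induct) (simp_all add: mult_single)

lemma sum_single_lookup:
  fixes m :: "'n::finite \<Rightarrow>\<^sub>0 'b::comm_monoid_add"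
  shows "(\<Sum>i\<in>UNIV. Poly_Mapping.single i (Poly_Mapping.lookup m i)) = m"
  by (rule poly_mapping_eqI) (simp add: lookup_sum lookup_single when_def)

lemma single_eq_Const_mult_Vars:
  "Poly_Mapping.single m c = Const c * (\<Prod>i\<in>UNIV. Var i ^ Poly_Mapping.lookup m i)"
  by (simp add: Var_power prod_single_one sum_single_lookup mult_single)

lemma sum_keys_single: "(\<Sum>m\<in>Poly_Mapping.keys p. Poly_Mapping.single m (Poly_Mapping.lookup p m)) = p"
  by (rule poly_mapping_eqI)
    (auto simp: lookup_sum lookup_single when_def in_keys_iff)

lemma mpoly_monomial_induct [case_names single add]:
  fixes p :: "'m \<Rightarrow>\<^sub>0 'a::comm_monoid_add"
  assumes "\<And>m c. P (Poly_Mapping.single m c)" and "\<And>p q. P p \<Longrightarrow> P q \<Longrightarrow> P (p + q)"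
  shows "P p"
proof -
  have "P 0" using assms(1)[of undefined 0] by simp
  then have "P (\<Sum>m\<in>M. Poly_Mapping.single m (c m))" for M c
    by (induction M rule: infinite_finite_induct) (simp_all add: assms)
  from this[of "Poly_Mapping.lookup p" "Poly_Mapping.keys p"] show ?thesis
    by (simp add: sum_keys_single)
qed

lemma mpoly_induct [case_names Const Var add mult]:
  fixes p :: "('a::comm_ring_1, 'n::finite) mpoly"
  assumes "\<And>c. P (Const c)" and "\<And>i. P (Var i)"
    and "\<And>p q. P p \<Longrightarrow> P q \<Longrightarrow> P (p + q)" and mult: "\<And>p q. P p \<Longrightarrow> P q \<Longrightarrow> P (p * q)"
  shows "P p"
proof (induction p rule: mpoly_monomial_induct)
  case (single m c)
  have one: "P 1" using assms(1)[of 1] by simp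
  have "P (Var i ^ k)" for i k
    by (induction k) (simp_all add: one assms)
  then have "P (\<Prod>i\<in>I. Var i ^ Poly_Mapping.lookup m i)" for I
    by (induction I rule: infinite_finite_induct) (simp_all add: one assms)
  then show ?case by (subst single_eq_Const_mult_Vars) (intro mult assms(1))
qed (use assms in auto)

section \<open>Evaluation at a point\<close>

lemma peval_single:
  "peval (Poly_Mapping.single m c) x = c * (\<Prod>i\<in>UNIV. (x $ i) ^ Poly_Mapping.lookup m i)"
  by (simp add: peval_def)

lemma peval_add: "peval (p + q) x = peval p x + peval q x"
  unfolding peval_def by (rule setsum_keys_plus_distrib) (simp_all add: algebra_simps)

lemma peval_0 [simp]: "peval 0 x = 0"
  by (simp add: peval_def)

lemma peval_Const [simp]: "peval (Const c) x = c"
  by (simp add: peval_single)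

lemma peval_1 [simp]: "peval 1 x = 1"
  using peval_Const[of 1] by simp

lemma peval_Var [simp]: "peval (Var i) x = x $ i"
proof -
  have "(\<Prod>j\<in>UNIV. (x $ j) ^ Poly_Mapping.lookup (Poly_Mapping.single i 1) j) =
      (\<Prod>j\<in>UNIV. if j = i then x $ j else 1)"
    by (rule prod.cong) (simp_all add: lookup_single when_def)
  then show ?thesis by (simp add: Var_def peval_single)
qed

lemma peval_mult: "peval (p * q) x = peval p x * peval q x"
proof (induction p rule: mpoly_monomial_induct)
  case (single m c)
  show ?case
  proof (induction q rule: mpoly_monomial_induct)
    case (single m' c')
    have "(\<Prod>i\<in>UNIV. (x $ i) ^ Poly_Mapping.lookup (m + m') i) =
        (\<Prod>i\<in>UNIV. (x $ i) ^ Poly_Mapping.lookup m i) * (\<Prod>i\<in>UNIV. (x $ i) ^ Poly_Mapping.lookup m' i)"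
      by (simp only: lookup_add power_add prod.distrib)
    then show ?case
      unfolding mult_single peval_single by (simp only: mult_ac)
  qed (simp add: peval_add distrib_left)
qed (simp add: peval_add distrib_right)

lemma peval_minus: "peval (- p) x = - peval p x"
  using peval_add[of p "- p" x] by (intro minus_unique[symmetric]) simp

lemma peval_diff: "peval (p - q) x = peval p x - peval q x"
  using peval_add[of p "- q" x] by (simp add: peval_minus)

lemma peval_sum: "peval (\<Sum>i\<in>I. p i) x = (\<Sum>i\<in>I. peval (p i) x)"
  by (induction I rule: infinite_finite_induct) (simp_all add: peval_add)

lemma peval_prod: "peval (\<Prod>i\<in>I. p i) x = (\<Prod>i\<in>I. peval (p i) x)"
  by (induction I rule: infinite_finite_induct) (simp_all add: peval_mult)

lemma peval_power: "peval (p ^ k) x = peval p x ^ k"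
  by (induction k) (simp_all add: peval_mult)

lemmas peval_simps = peval_add peval_mult peval_minus peval_diff peval_sum peval_prod peval_power

section \<open>Partial and directional derivatives\<close>

lemma partial_deriv_add: "partial_deriv i (p + q) = partial_deriv i p + partial_deriv i q"
  unfolding partial_deriv_def
  by (rule setsum_keys_plus_distrib) (simp_all add: algebra_simps single_add)

lemma partial_deriv_single:
  "partial_deriv i (Poly_Mapping.single m c) =
     Poly_Mapping.single (m - Poly_Mapping.single i 1) (of_nat (Poly_Mapping.lookup m i) * c)"
  by (simp add: partial_deriv_def)

lemma partial_deriv_mult:
  fixes p q :: "('a::comm_ring_1, 'n::finite) mpoly"
  shows "partial_deriv i (p * q) = partial_deriv i p * q + p * partial_deriv i q"
proof (induction p rule: mpoly_monomial_induct)
  case (single m c)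
  show ?case
  proof (induction q rule: mpoly_monomial_induct)
    case (single m' c')
    \<comment> \<open>Truncated subtraction commutes with adding \<open>k'\<close> only if
      \<open>i\<close> occurs in \<open>k\<close>; otherwise the coefficient is zero.\<close>
    have shift: "Poly_Mapping.single (k + k' - Poly_Mapping.single i 1) (of_nat (Poly_Mapping.lookup k i) * d) =
        Poly_Mapping.single ((k - Poly_Mapping.single i 1) + k') (of_nat (Poly_Mapping.lookup k i) * d)"
      for k k' :: "'n \<Rightarrow>\<^sub>0 nat" and d :: 'a
    proof (cases "Poly_Mapping.lookup k i = 0")
      case False
      then have "k + k' - Poly_Mapping.single i 1 = (k - Poly_Mapping.single i 1) + k'"
        by (intro poly_mapping_eqI) (auto simp: lookup_add lookup_minus lookup_single when_def)
      then show ?thesis by simp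
    qed simp
    let ?e = "Poly_Mapping.single i 1 :: 'n \<Rightarrow>\<^sub>0 nat"
    have "partial_deriv i (Poly_Mapping.single m c * Poly_Mapping.single m' c') =
        Poly_Mapping.single (m + m' - ?e) (of_nat (Poly_Mapping.lookup m i) * (c * c')) +
        Poly_Mapping.single (m' + m - ?e) (of_nat (Poly_Mapping.lookup m' i) * (c * c'))"
      by (simp only: mult_single partial_deriv_single lookup_add of_nat_add distrib_right
          single_add add.commute[of m' m])
    also have "\<dots> = Poly_Mapping.single ((m - ?e) + m') (of_nat (Poly_Mapping.lookup m i) * c * c') +
        Poly_Mapping.single (m + (m' - ?e)) (c * (of_nat (Poly_Mapping.lookup m' i) * c'))"
      by (simp only: shift add.commute[of m "m' - ?e"] mult.assoc mult.left_commute[of c])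
    finally show ?case by (simp only: mult_single partial_deriv_single)
  qed (simp add: partial_deriv_add distrib_left distrib_right add_ac)
qed (simp add: partial_deriv_add distrib_left distrib_right add_ac)

lemma partial_deriv_Const [simp]: "partial_deriv i (Const c) = 0"
  by (simp add: partial_deriv_single)

lemma partial_deriv_Var: "partial_deriv i (Var j) = (if i = j then 1 else 0)"
  by (simp add: Var_def partial_deriv_single lookup_single when_def)

lemma form_deriv_mult: "form_deriv l (p * q) = form_deriv l p * q + p * form_deriv l q"
  by (simp add: form_deriv_def partial_deriv_mult sum.distrib sum_distrib_left sum_distrib_right algebra_simps)

lemma form_deriv_Const [simp]: "form_deriv l (Const c) = 0"
  by (simp add: form_deriv_def)

section \<open>Polynomials as functions over an infinite field\<close>

lemma poly_eq_0_if_all_zero: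
  fixes q :: "'a::field_char_0 poly"
  assumes "\<And>t. poly q t = 0"
  shows "q = 0"
  using assms poly_all_0_iff_0 by blast

text \<open>With the variables in \<open>V\<close> fixed, the sum is a univariate polynomial in the
  new variable \<open>j\<close>, so each coefficient vanishes. Exponents are restricted functions,
  so that variables can be removed in the induction.\<close>

lemma monomials_independent:
  fixes c :: "'m \<Rightarrow> 'a::field_char_0" and e :: "'m \<Rightarrow> 'n \<Rightarrow> nat"
  assumes "finite V" "finite M" "inj_on (\<lambda>m. restrict (e m) V) M"
    and "\<And>x. (\<Sum>m\<in>M. c m * (\<Prod>i\<in>V. x i ^ e m i)) = 0" "m \<in> M"
  shows "c m = 0"
  using assms
proof (induction V arbitrary: M m rule: finite_induct)
  case empty
  then have "M = {m}" by (auto simp: inj_on_def restrict_def)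
  then show ?case using empty by simp
next
  case (insert j V)
  \<comment> \<open>The monomials sharing the \<open>j\<close>-exponent of \<open>m\<close> make up
    one coefficient; they still differ in the remaining variables.\<close>
  define N where "N = {m' \<in> M. e m' j = e m j}"
  have "finite N" using insert.prems by (simp add: N_def)
  have "inj_on (\<lambda>m. restrict (e m) V) N"
  proof (rule inj_onI)
    fix a b assume ab: "a \<in> N" "b \<in> N" "restrict (e a) V = restrict (e b) V"
    have "e a i = e b i" if "i \<in> V" for i
      using fun_cong[OF ab(3), of i] that by simp
    then have "restrict (e a) (insert j V) i = restrict (e b) (insert j V) i" for i
      using ab by (auto simp: N_def)
    then have "restrict (e a) (insert j V) = restrict (e b) (insert j V)" by (rule ext)
    moreover have "a \<in> M" "b \<in> M" using ab by (auto simp: N_def)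
    ultimately show "a = b" using inj_onD[OF insert.prems(2)] by blast
  qed
  moreover have "(\<Sum>m\<in>N. c m * (\<Prod>i\<in>V. x i ^ e m i)) = 0" for x
  proof -
    define q where "q = (\<Sum>m\<in>M. monom (c m * (\<Prod>i\<in>V. x i ^ e m i)) (e m j))"
    have "poly q t = 0" for t
    proof -
      have "(\<Prod>i\<in>V. (x(j := t)) i ^ k i) = (\<Prod>i\<in>V. x i ^ k i)" for k :: "'n \<Rightarrow> nat"
        using insert.hyps by (intro prod.cong) auto
      then show ?thesis
        using insert.prems(3)[of "x(j := t)"] insert.hyps
        by (simp add: q_def poly_sum poly_monom mult_ac)
    qed
    then have "q = 0" by (rule poly_eq_0_if_all_zero)
    then have "coeff q (e m j) = 0" by simp
    moreover have "coeff q (e m j) = (\<Sum>m'\<in>M. if e m' j = e m j then c m' * (\<Prod>i\<in>V. x i ^ e m' i) else 0)"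
      by (simp add: q_def coeff_sum)
    moreover have "\<dots> = (\<Sum>m\<in>N. c m * (\<Prod>i\<in>V. x i ^ e m i))"
      using insert.prems unfolding N_def by (intro sum.inter_filter[symmetric])
    ultimately show ?thesis by simp
  qed
  moreover have "m \<in> N" using insert.prems(4) by (simp add: N_def)
  ultimately show ?case by (rule insert.IH[OF \<open>finite N\<close>])
qed

lemma peval_eq_0_imp:
  fixes p :: "('a::field_char_0, 'n::finite) mpoly"
  assumes "\<And>x. peval p x = 0"
  shows "p = 0"
proof (rule poly_mapping_eqI)
  fix m
  have "Poly_Mapping.lookup p m = 0" if "m \<in> Poly_Mapping.keys p"
  proof (rule monomials_independent[where V = UNIV and M = "Poly_Mapping.keys p" and e = Poly_Mapping.lookup])
    show "inj_on (\<lambda>m. restrict (Poly_Mapping.lookup m) UNIV) (Poly_Mapping.keys p)"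
      by (auto intro!: inj_onI simp: restrict_UNIV)
    show "(\<Sum>m\<in>Poly_Mapping.keys p. Poly_Mapping.lookup p m * (\<Prod>i\<in>UNIV. x i ^ Poly_Mapping.lookup m i)) = 0" for x
      using assms[of "\<chi> i. x i"] by (simp add: peval_def)
  qed (use that in auto)
  then show "Poly_Mapping.lookup p m = Poly_Mapping.lookup 0 m"
    by (auto simp: in_keys_iff)
qed

lemma ex_poly_on_line:
  "\<exists>q. \<forall>t. poly q t = peval p (x + t *s v)"
proof (induction p rule: mpoly_induct)
  case (Const c)
  show ?case by (rule exI[of _ "[:c:]"]) simp
next
  case (Var i)
  show ?case by (rule exI[of _ "[:x $ i, v $ i:]"]) simp
next
  case (add p q)
  then obtain p' q' where "\<forall>t. poly p' t = peval p (x + t *s v)" "\<forall>t. poly q' t = peval q (x + t *s v)"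
    by blast
  then show ?case by (intro exI[of _ "p' + q'"]) (simp add: peval_add)
next
  case (mult p q)
  then obtain p' q' where "\<forall>t. poly p' t = peval p (x + t *s v)" "\<forall>t. poly q' t = peval q (x + t *s v)"
    by blast
  then show ?case by (intro exI[of _ "p' * q'"]) (simp add: peval_mult)
qed

text \<open>Two polynomials that are not identically zero on \<open>V\<close> are not identically zero on the line
  joining suitable points of \<open>V\<close>, which reduces the claim to one variable.\<close>

lemma vanishing_on_subspace_prime:
  fixes p q :: "('a::field_char_0, 'n::finite) mpoly"
  assumes V: "vec.subspace V" and pq: "\<forall>x\<in>V. peval (p * q) x = 0"
  shows "(\<forall>x\<in>V. peval p x = 0) \<or> (\<forall>x\<in>V. peval q x = 0)"
proof (rule ccontr)
  assume "\<not> ?thesis"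
  then obtain x y where xy: "x \<in> V" "peval p x \<noteq> 0" "y \<in> V" "peval q y \<noteq> 0" by blast
  obtain p' q' where p': "\<forall>t. poly p' t = peval p (x + t *s (y - x))"
    and q': "\<forall>t. poly q' t = peval q (x + t *s (y - x))"
    using ex_poly_on_line by metis
  have "poly (p' * q') t = 0" for t
    using V pq xy by (simp add: p' q' peval_mult vec.subspace_add vec.subspace_scale vec.subspace_diff)
  then have "p' * q' = 0" by (rule poly_eq_0_if_all_zero)
  moreover have "poly p' 0 \<noteq> 0" "poly q' 1 \<noteq> 0" using xy by (simp_all add: p' q')
  ultimately show False by auto
qed

lemma mpoly_no_zero_divisors:
  fixes p q :: "('a::field_char_0, 'n::finite) mpoly"
  assumes "p * q = 0"
  shows "p = 0 \<or> q = 0"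
  using vanishing_on_subspace_prime[of UNIV p q] assms peval_eq_0_imp by auto

lemma peval_ext:
  fixes p q :: "('a::field_char_0, 'n::finite) mpoly"
  assumes "\<And>x. peval p x = peval q x"
  shows "p = q"
  using peval_eq_0_imp[of "p - q"] assms by (simp add: peval_diff)

section \<open>Linear forms\<close>

declare One_nat_def [simp del]

definition linear_form :: "'a::comm_ring_1 ^ 'n::finite \<Rightarrow> ('a, 'n) mpoly" where
  "linear_form a = (\<Sum>i\<in>UNIV. Const (a $ i) * Var i)"

lemma Const_mult_Var: "Const c * Var i = Poly_Mapping.single (Poly_Mapping.single i 1) c"
  by (simp add: Var_def mult_single)

lemma lookup_linear_form:
  "Poly_Mapping.lookup (linear_form a) m =
     (\<Sum>i\<in>UNIV. if Poly_Mapping.single i 1 = m then a $ i else 0)"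
  by (simp add: linear_form_def Const_mult_Var lookup_sum lookup_single when_def)

lemma single_one_inj: "Poly_Mapping.single i (1::nat) = Poly_Mapping.single j 1 \<longleftrightarrow> i = j"
  by (metis lookup_single_eq lookup_single_not_eq one_neq_zero)

lemma dual_vec_linear_form [simp]: "dual_vec (linear_form a) = a"
  by (simp add: vec_eq_iff dual_vec_def lookup_linear_form single_one_inj)

lemma linear_form_in_forms: "linear_form a \<in> forms 1"
proof -
  have "(\<Sum>j\<in>UNIV. Poly_Mapping.lookup m j) = 1" if "m \<in> Poly_Mapping.keys (linear_form a)" for m
  proof -
    have "\<exists>i. Poly_Mapping.single i 1 = m"
    proof (rule ccontr)
      assume "\<nexists>i. Poly_Mapping.single i 1 = m"
      then have "Poly_Mapping.lookup (linear_form a) m = 0" by (simp add: lookup_linear_form)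
      then show False using that by (simp add: in_keys_iff)
    qed
    then obtain i where "Poly_Mapping.single i 1 = m" by blast
    then have "(\<Sum>j\<in>UNIV. Poly_Mapping.lookup m j) = (\<Sum>j\<in>UNIV. if j = i then 1 else 0)"
      by (intro sum.cong) (auto simp: lookup_single when_def)
    then show ?thesis by simp
  qed
  then show ?thesis by (simp add: forms_def)
qed

lemma exponent_of_degree_one:
  fixes m :: "'n::finite \<Rightarrow>\<^sub>0 nat"
  assumes "(\<Sum>i\<in>UNIV. Poly_Mapping.lookup m i) = 1"
  obtains i where "m = Poly_Mapping.single i 1"
proof -
  obtain i where "Poly_Mapping.lookup m i = 1" "\<And>j. j \<noteq> i \<Longrightarrow> Poly_Mapping.lookup m j = 0"
    using assms sum_eq_1_iff[of UNIV "Poly_Mapping.lookup m"] by auto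
  then have "m = Poly_Mapping.single i 1"
    by (intro poly_mapping_eqI) (auto simp: lookup_single when_def)
  then show ?thesis by (rule that)
qed

lemma forms_1_eq_linear_form:
  assumes "h \<in> forms 1"
  shows "h = linear_form (dual_vec h)"
proof (rule poly_mapping_eqI)
  fix m
  show "Poly_Mapping.lookup h m = Poly_Mapping.lookup (linear_form (dual_vec h)) m"
  proof (cases "\<exists>i. m = Poly_Mapping.single i 1")
    case True
    then show ?thesis by (auto simp: lookup_linear_form single_one_inj dual_vec_def)
  next
    case False
    then have "m \<notin> Poly_Mapping.keys h" "m \<notin> Poly_Mapping.keys (linear_form (dual_vec h))"
      using assms linear_form_in_forms exponent_of_degree_one unfolding forms_def by blast+
    then show ?thesis by (simp add: in_keys_iff)
  qed
qed

lemma forms_1_cases: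
  assumes "h \<in> forms 1"
  obtains a where "h = linear_form a"
  using forms_1_eq_linear_form[OF assms] by blast

lemma forms_1_diff:
  assumes "h \<in> forms 1" "k \<in> forms 1"
  shows "h - k \<in> forms 1"
proof -
  obtain a b where "h = linear_form a" "k = linear_form b" using assms forms_1_cases by metis
  then have "h - k = linear_form (a - b)"
    by (simp add: linear_form_def single_diff algebra_simps sum_subtractf)
  then show ?thesis by (simp add: linear_form_in_forms)
qed

lemma Const_mult_linear_form: "Const c * linear_form a = linear_form (c *s a)"
  by (simp add: linear_form_def Const_mult sum_distrib_left mult.assoc)

lemma forms_1_scale:
  assumes "h \<in> forms 1"
  shows "Const c * h \<in> forms 1"
proof -
  obtain a where "h = linear_form a" using assms forms_1_cases by metis
  then show ?thesis by (simp only: Const_mult_linear_form linear_form_in_forms)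
qed

lemma peval_form:
  assumes "h \<in> forms 1"
  shows "peval h x = (\<Sum>i\<in>UNIV. dual_vec h $ i * x $ i)"
  by (subst forms_1_eq_linear_form[OF assms]) (simp add: linear_form_def peval_simps)

lemma peval_form_add: "h \<in> forms 1 \<Longrightarrow> peval h (x + y) = peval h x + peval h y"
  by (simp add: peval_form sum.distrib algebra_simps)

lemma peval_form_diff: "h \<in> forms 1 \<Longrightarrow> peval h (x - y) = peval h x - peval h y"
  by (simp add: peval_form sum_subtractf algebra_simps)

lemma peval_form_scale: "h \<in> forms 1 \<Longrightarrow> peval h (c *s x) = c * peval h x"
  by (simp add: peval_form sum_distrib_left algebra_simps)

lemma peval_form_0: "h \<in> forms 1 \<Longrightarrow> peval h 0 = 0"
  by (simp add: peval_form)

lemma subspace_form_kernel: "h \<in> forms 1 \<Longrightarrow> vec.subspace {x. peval h x = 0}"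
  by (rule vec.subspaceI) (auto simp: peval_form_0 peval_form_add peval_form_scale)

lemma dual_vec_diff: "dual_vec (p - q) = dual_vec p - dual_vec q"
  by (simp add: dual_vec_def vec_eq_iff lookup_minus)

lemma dual_vec_Const_mult:
  assumes "y \<in> forms 1"
  shows "dual_vec (Const c * y) = c *s dual_vec y"
proof -
  obtain b where b: "y = linear_form b" using assms by (rule forms_1_cases)
  show ?thesis by (simp add: b Const_mult_linear_form)
qed

lemma partial_deriv_0 [simp]: "partial_deriv i 0 = 0"
  by (simp add: partial_deriv_def)

lemma partial_deriv_sum: "partial_deriv i (\<Sum>j\<in>J. p j) = (\<Sum>j\<in>J. partial_deriv i (p j))"
  by (induction J rule: infinite_finite_induct) (simp_all add: partial_deriv_add)

lemma partial_deriv_form: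
  assumes "h \<in> forms 1"
  shows "partial_deriv i h = Const (dual_vec h $ i)"
proof -
  have "partial_deriv i h = (\<Sum>j\<in>UNIV. if j = i then Const (dual_vec h $ j) else 0)"
    by (subst forms_1_eq_linear_form[OF assms], unfold linear_form_def partial_deriv_sum)
      (intro sum.cong; simp add: partial_deriv_mult partial_deriv_Var)
  then show ?thesis by simp
qed

lemma sum_Const: "(\<Sum>i\<in>I. Const (c i)) = Const (\<Sum>i\<in>I. c i)"
  by (induction I rule: infinite_finite_induct) (simp_all add: single_add)

text \<open>Differentiating a linear form along \<open>l\<close> pairs the two coefficient vectors.
  A form scaled to value 1 at the dual point of \<open>l\<close> therefore has directional
  derivative 1.\<close>

lemma form_deriv_form:
  assumes "h \<in> forms 1"
  shows "form_deriv l h = Const (peval h (dual_vec l))"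
  by (simp add: form_deriv_def partial_deriv_form[OF assms] peval_form[OF assms]
      Const_mult[symmetric] sum_Const mult.commute)

section \<open>Ideals of linear subspaces\<close>

lemma mem_ideal_span_pair: "p \<in> ideal.span {x, y} \<longleftrightarrow> (\<exists>c d. p = c * x + d * y)"
proof -
  have "p \<in> ideal.span {x, y} \<longleftrightarrow> (\<exists>c d. p - c * x = d * y)"
    by (auto simp: ideal.span_insert ideal.span_singleton)
  then show ?thesis by (simp add: algebra_simps)
qed

section \<open>Substitution of projections\<close>

lemma substitute_mod_ideal:
  assumes I: "ideal.subspace I" and g: "\<And>i. Var i - g i \<in> I"
  shows "\<exists>q. p - q \<in> I \<and> (\<forall>x. peval q x = peval p (\<chi> i. peval (g i) x))"
proof (induction p rule: mpoly_induct)
  case (Const c)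
  show ?case by (rule exI[of _ "Const c"]) (simp add: ideal.subspace_0[OF I])
next
  case (Var i)
  show ?case by (rule exI[of _ "g i"]) (simp add: g)
next
  case (add p q)
  then obtain p' q' where pq: "p - p' \<in> I" "q - q' \<in> I"
    "\<forall>x. peval p' x = peval p (\<chi> i. peval (g i) x)" "\<forall>x. peval q' x = peval q (\<chi> i. peval (g i) x)"
    by blast
  have "p + q - (p' + q') = (p - p') + (q - q')" by simp
  then have "p + q - (p' + q') \<in> I" using ideal.subspace_add[OF I] pq(1,2) by metis
  then show ?case using pq(3,4) by (intro exI[of _ "p' + q'"]) (simp add: peval_add)
next
  case (mult p q)
  then obtain p' q' where pq: "p - p' \<in> I" "q - q' \<in> I"
    "\<forall>x. peval p' x = peval p (\<chi> i. peval (g i) x)" "\<forall>x. peval q' x = peval q (\<chi> i. peval (g i) x)"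
    by blast
  have "p * q - p' * q' = q * (p - p') + p' * (q - q')" by (simp add: algebra_simps)
  then have "p * q - p' * q' \<in> I"
    using ideal.subspace_add[OF I] ideal.subspace_scale[OF I] pq(1,2) by metis
  then show ?case using pq(3,4) by (intro exI[of _ "p' * q'"]) (simp add: peval_mult)
qed

text \<open>This serves as a Nullstellensatz for linear subspaces: for \<open>g\<close> a projection
  onto a subspace where \<open>p\<close> vanishes, the substituted polynomial is zero, so
  \<open>p\<close> is zero modulo \<open>I\<close>.\<close>

lemma mem_ideal_if_vanishing:
  fixes p :: "('a::field_char_0, 'n::finite) mpoly"
  assumes "ideal.subspace I" "\<And>i. Var i - g i \<in> I" "\<And>x. peval p (\<chi> i. peval (g i) x) = 0"
  shows "p \<in> I"
proof -
  obtain q where "p - q \<in> I" "\<forall>x. peval q x = peval p (\<chi> i. peval (g i) x)"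
    using substitute_mod_ideal[OF assms(1,2)] by metis
  moreover from this have "q = 0" by (intro peval_eq_0_imp) (simp add: assms(3))
  ultimately show ?thesis by simp
qed

lemma ex_peval_form_eq_1:
  fixes h :: "('a::field_char_0, 'n::finite) mpoly"
  assumes "h \<in> forms 1" "h \<noteq> 0"
  obtains a where "peval h a = 1"
proof -
  obtain a where "peval h a \<noteq> 0" using assms(2) peval_eq_0_imp by blast
  then have "peval h ((1 / peval h a) *s a) = 1" by (simp add: peval_form_scale[OF assms(1)])
  then show ?thesis by (rule that)
qed

text \<open>The projection along \<open>a\<close> onto the kernel of \<open>h\<close> is a substitution that is trivial modulo \<open>h\<close>.\<close>

lemma form_dvd_iff:
  fixes h p :: "('a::field_char_0, 'n::finite) mpoly"
  assumes h: "h \<in> forms 1" "h \<noteq> 0"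
  shows "h dvd p \<longleftrightarrow> (\<forall>x. peval h x = 0 \<longrightarrow> peval p x = 0)"
proof
  assume vanish: "\<forall>x. peval h x = 0 \<longrightarrow> peval p x = 0"
  obtain a where a: "peval h a = 1" using ex_peval_form_eq_1[OF h] .
  have "p \<in> {q. h dvd q}"
  proof (rule mem_ideal_if_vanishing)
    show "ideal.subspace {q. h dvd q}" by (auto simp: ideal.subspace_def)
    show "Var i - (Var i - Const (a $ i) * h) \<in> {q. h dvd q}" for i by simp
    fix x
    have "(\<chi> i. peval (Var i - Const (a $ i) * h) x) = x - peval h x *s a"
      by (simp add: vec_eq_iff peval_simps mult.commute)
    moreover have "peval h (x - peval h x *s a) = 0"
      by (simp add: peval_form_diff[OF h(1)] peval_form_scale[OF h(1)] a)
    ultimately show "peval p (\<chi> i. peval (Var i - Const (a $ i) * h) x) = 0" using vanish by simp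
  qed
  then show "h dvd p" by simp
qed (auto simp: dvd_def peval_mult)

text \<open>The vector \<open>a\<close> is completed by some \<open>b\<close> to a pair dual to
  \<open>x\<close>, \<open>y\<close>. The projection \<open>z - x(z) a - y(z) b\<close> onto the
  common kernel is trivial modulo the two forms.\<close>

lemma mem_ideal_of_two_forms_iff:
  fixes x y p :: "('a::field_char_0, 'n::finite) mpoly"
  assumes x: "x \<in> forms 1" and y: "y \<in> forms 1" "y \<noteq> 0"
    and a: "peval x a = 1" "peval y a = 0"
  shows "(\<exists>c d. p = c * x + d * y) \<longleftrightarrow> (\<forall>z. peval x z = 0 \<longrightarrow> peval y z = 0 \<longrightarrow> peval p z = 0)"
proof
  assume vanish: "\<forall>z. peval x z = 0 \<longrightarrow> peval y z = 0 \<longrightarrow> peval p z = 0"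
  obtain b' where "peval y b' = 1" using ex_peval_form_eq_1[OF y] .
  then have "peval y (b' - peval x b' *s a) = 1" "peval x (b' - peval x b' *s a) = 0"
    by (auto simp add: peval_form_diff peval_form_scale x y a)
  then obtain b where b: "peval y b = 1" "peval x b = 0" by blast
  have "p \<in> ideal.span {x, y}"
  proof (rule mem_ideal_if_vanishing)
    let ?g = "\<lambda>i. Var i - Const (a $ i) * x - Const (b $ i) * y"
    show "Var i - ?g i \<in> ideal.span {x, y}" for i
      unfolding mem_ideal_span_pair by (rule exI[of _ "Const (a $ i)"], rule exI[of _ "Const (b $ i)"]) simp
    fix z
    have "(\<chi> i. peval (?g i) z) = z - peval x z *s a - peval y z *s b"
      by (simp add: vec_eq_iff peval_simps mult.commute)
    then show "peval p (\<chi> i. peval (?g i) z) = 0"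
      using vanish a b by (simp add: peval_form_diff peval_form_scale x y)
  qed simp
  then show "\<exists>c d. p = c * x + d * y" by (simp add: mem_ideal_span_pair)
qed (auto simp: peval_simps)

text \<open>Divisibility by \<open>h\<close> is vanishing on its kernel, a linear subspace, where
  vanishing is a prime condition.\<close>

lemma prime_elem_form:
  fixes h :: "('a::field_char_0, 'n::finite) mpoly"
  assumes h: "h \<in> forms 1" "h \<noteq> 0"
  shows "prime_elem h"
proof (rule prime_elemI)
  show "\<not> h dvd 1" using peval_form_0[OF h(1)] by (auto simp: form_dvd_iff[OF h])
  fix p q assume "h dvd p * q"
  then show "h dvd p \<or> h dvd q"
    using vanishing_on_subspace_prime[OF subspace_form_kernel[OF h(1)], of p q]
    by (auto simp: form_dvd_iff[OF h])
qed (use h in simp)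

section \<open>Divisibility by products of distinct primes\<close>

lemma prime_elem_dvd_prodD:
  fixes f :: "'i \<Rightarrow> 'r::comm_semiring_1"
  assumes "prime_elem p" "p dvd (\<Prod>i\<in>L. f i)" "finite L"
  shows "\<exists>i\<in>L. p dvd f i"
  using assms(3,2)
  by (induction L rule: finite_induct) (use assms(1) in \<open>auto simp: prime_elem_dvd_mult_iff prime_elem_not_unit\<close>)

text \<open>The next prime divides none of the earlier factors, so it divides the remaining
  cofactor.\<close>

lemma prod_of_primes_dvd:
  fixes f :: "'i \<Rightarrow> 'r::comm_semiring_1"
  assumes "finite L" "\<And>i. i \<in> L \<Longrightarrow> prime_elem (f i)" "\<And>i. i \<in> L \<Longrightarrow> f i dvd q"
    and "\<And>i j. i \<in> L \<Longrightarrow> j \<in> L \<Longrightarrow> f i dvd f j \<Longrightarrow> i = j"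
  shows "(\<Prod>i\<in>L. f i) dvd q"
  using assms
proof (induction L rule: finite_induct)
  case (insert j L)
  have "(\<Prod>i\<in>L. f i) dvd q" using insert.prems by (intro insert.IH) auto
  then obtain w where w: "q = (\<Prod>i\<in>L. f i) * w" by (rule dvdE)
  have "\<not> f j dvd (\<Prod>i\<in>L. f i)"
  proof
    assume "f j dvd (\<Prod>i\<in>L. f i)"
    then obtain i where "i \<in> L" "f j dvd f i"
      using prime_elem_dvd_prodD[of "f j" f L] insert.prems(1)[of j] insert.hyps(1) by auto
    then show False using insert.prems(3)[of j i] insert.hyps(2) by auto
  qed
  moreover have "f j dvd (\<Prod>i\<in>L. f i) * w" using insert.prems(2)[of j] w by simp
  ultimately have "f j dvd w" using insert.prems(1)[of j] prime_elem_dvd_multD[of "f j"] by auto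
  then show ?case using insert.hyps w by (simp add: mult_dvd_mono mult.commute)
qed simp

section \<open>Hyperplanes through a flat\<close>

lemma prod_congruence_mod_y:
  fixes x y :: "'r::comm_ring_1"
  shows "\<exists>s. (\<Prod>i\<in>L. x - c i * y) = x ^ card L + y * s"
proof (induction L rule: infinite_finite_induct)
  case (insert j L)
  then obtain s where "(\<Prod>i\<in>L. x - c i * y) = x ^ card L + y * s" by blast
  then have "(\<Prod>i\<in>insert j L. x - c i * y) =
      x ^ card (insert j L) + y * (x * s - c j * (x ^ card L + y * s))"
    using insert.hyps by (simp add: algebra_simps)
  then show ?case by blast
qed (auto intro: exI[of _ 0])

text \<open>Modulo \<open>x\<close> each factor becomes a constant times \<open>y\<close>. Over a
  field the product of these constants is nonzero when no \<open>b i\<close> vanishes, that is, when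
  \<open>x\<close> itself is not a factor.\<close>

lemma prod_congruence_mod_x:
  fixes x y :: "('a::comm_ring_1, 'n::finite) mpoly"
  shows "\<exists>s. (\<Prod>i\<in>L. x - Const (b i) * y) = Const (\<Prod>i\<in>L. - b i) * y ^ card L + x * s"
proof (induction L rule: infinite_finite_induct)
  case (insert j L)
  then obtain s where s: "(\<Prod>i\<in>L. x - Const (b i) * y) = Const (\<Prod>i\<in>L. - b i) * y ^ card L + x * s" by blast
  have "(\<Prod>i\<in>insert j L. x - Const (b i) * y) =
      Const (\<Prod>i\<in>insert j L. - b i) * y ^ card (insert j L) +
      x * (Const (\<Prod>i\<in>L. - b i) * y ^ card L + x * s - Const (b j) * y * s)"
    using insert.hyps s by (simp add: Const_mult single_uminus algebra_simps)
  then show ?case by blast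
qed (auto intro: exI[of _ 0])

text \<open>Reducing the factorization of \<open>y u + \<kappa> p x\<close> first modulo \<open>y\<close> and then modulo \<open>x\<close> shows that
  \<open>u\<close> lies in the ideal generated by \<open>x\<close> and \<open>y\<^sup>s\<close>.\<close>

lemma interpolant_mod_axis_power:
  fixes x y :: "('a::comm_ring_1, 'n::finite) mpoly"
  assumes "finite L" and x: "prime_elem x" "\<not> x dvd y" and y: "prime_elem y" "\<not> y dvd x"
    and prime: "\<And>i. i \<in> L \<Longrightarrow> prime_elem (x - Const (b i) * y)"
    and distinct: "\<And>i j. i \<in> L \<Longrightarrow> j \<in> L \<Longrightarrow> x - Const (b i) * y dvd x - Const (b j) * y \<Longrightarrow> i = j"
    and u: "\<And>i. i \<in> L \<Longrightarrow> x - Const (b i) * y dvd y * u + k * p * x"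
    and p: "p = y * p1 + x ^ card L * p2"
  shows "\<exists>w. x dvd u - y ^ card L * w"
proof -
  define n where "n = card L"
  define Q where "Q = (\<Prod>i\<in>L. x - Const (b i) * y)"
  have "Q dvd y * u + k * p * x"
    unfolding Q_def using \<open>finite L\<close> prime u distinct by (rule prod_of_primes_dvd)
  then obtain w where w: "y * u + k * p * x = Q * w" by (rule dvdE)
  obtain s where s: "Q = x ^ n + y * s"
    using prod_congruence_mod_y[of x "\<lambda>i. Const (b i)" y L] unfolding Q_def n_def by blast
  obtain \<beta> s' where s': "Q = Const \<beta> * y ^ n + x * s'"
    using prod_congruence_mod_x[of x b y L] unfolding Q_def n_def by blast
  \<comment> \<open>Modulo \<open>y\<close> both \<open>Q\<close> and \<open>p\<close> are multiples
    of \<open>x ^ n\<close>, which is cancelled because \<open>y\<close> is a prime not dividing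
    \<open>x\<close>.\<close>
  have "x ^ n * (k * p2 * x - w) = y * (s * w - u - k * p1 * x)"
    using w unfolding s p n_def[symmetric] by (simp add: algebra_simps)
  then have "y dvd x ^ n * (k * p2 * x - w)" by simp
  then have "y dvd k * p2 * x - w"
    using y prime_elem_dvd_multD prime_elem_dvd_power by blast
  then obtain v where v: "k * p2 * x - w = y * v" by (rule dvdE)
  have w': "w = k * p2 * x - y * v" using v by (simp add: algebra_simps)
  \<comment> \<open>The factorization controls only \<open>y * u\<close>, hence the extra factor
    \<open>y\<close>, cancelled modulo \<open>x\<close> at the end. The terms in
    \<open>Q * y * v\<close> cancel.\<close>
  have "y * (u + Const \<beta> * y ^ n * v) = y * u + y * (Const \<beta> * y ^ n) * v"
    by (simp add: algebra_simps)
  also have "\<dots> = Q * w - k * p * x + y * (Q - x * s') * v"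
  proof -
    have "Const \<beta> * y ^ n = Q - x * s'" using s' by simp
    moreover have "y * u = Q * w - k * p * x" using w by (simp only: eq_diff_eq)
    ultimately show ?thesis by (simp only:)
  qed
  also have "\<dots> = x * (Q * k * p2 - k * p - s' * y * v)"
    unfolding w' by (simp add: algebra_simps)
  finally have "x dvd y * (u + Const \<beta> * y ^ n * v)" by simp
  then have "x dvd u + Const \<beta> * y ^ n * v" using x prime_elem_dvd_multD by blast
  then have "x dvd u - y ^ n * (- (Const \<beta> * v))" by (simp add: algebra_simps)
  then show ?thesis unfolding n_def by blast
qed

lemma dim_form_kernel:
  fixes h :: "('a::field_char_0, 'n::finite) mpoly"
  assumes h: "h \<in> forms 1" "h \<noteq> 0"
  shows "vec.dim {z. peval h z = 0} + 1 = CARD('n)"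
proof -
  let ?V = "{z. peval h z = 0}"
  obtain e where e: "peval h e = 1" using ex_peval_form_eq_1[OF h] .
  have span_V: "vec.span ?V = ?V" using subspace_form_kernel[OF h(1)] by (simp only: vec.span_eq_iff)
  have "z \<in> vec.span (insert e ?V)" for z
    unfolding vec.span_breakdown_eq span_V
    by (rule exI[of _ "peval h z"]) (simp add: peval_form_diff peval_form_scale h e)
  then have "vec.span (insert e ?V) = UNIV" by blast
  then have "vec.dim (insert e ?V) = CARD('n)"
    using vec.dim_span[of "insert e ?V"] vec_dim_card by metis
  moreover have "vec.dim (insert e ?V) = vec.dim ?V + 1"
    using e by (simp add: vec.dim_insert span_V)
  ultimately show ?thesis by simp
qed

text \<open>For a flat \<open>P\<close> of codimension two not containing \<open>a\<close>, this is
  a form of the hyperplane joining them. Vanishing conditions replace the span, so that a difference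
  of normalized forms qualifies at once.\<close>

definition axis_form ::
    "'a ^ 'n \<Rightarrow> ('a::field_char_0 ^ 'n::finite) set \<Rightarrow> ('a, 'n) mpoly \<Rightarrow> bool" where
  "axis_form a P y \<longleftrightarrow> y \<in> forms 1 \<and> y \<noteq> 0 \<and> peval y a = 0 \<and> (\<forall>z\<in>P. peval y z = 0)"

text \<open>The point \<open>a\<close> stands for the dual of a general form \<open>l\<close>.
  Scaling to value 1 at \<open>a\<close> makes differences of the forms vanish there and their
  derivatives along \<open>l\<close> equal to 1.\<close>

locale normalized_arrangement =
  fixes A :: "('a::field_char_0 ^ 'n::finite) set set"
    and g :: "('a ^ 'n) set \<Rightarrow> ('a, 'n) mpoly"
    and a :: "'a ^ 'n"
  assumes finite_A: "finite A"
    and form: "H \<in> A \<Longrightarrow> g H \<in> forms 1"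
    and peval_a: "H \<in> A \<Longrightarrow> peval (g H) a = 1"
    and kernel: "H \<in> A \<Longrightarrow> z \<in> H \<longleftrightarrow> peval (g H) z = 0"
begin

section \<open>Normalized forms through a common flat\<close>

lemma nonzero: "H \<in> A \<Longrightarrow> g H \<noteq> 0"
  using peval_a by force

lemma prime: "H \<in> A \<Longrightarrow> prime_elem (g H)"
  using prime_elem_form form nonzero by blast

lemma vanishes_on_subset: "H \<in> A \<Longrightarrow> P \<subseteq> H \<Longrightarrow> z \<in> P \<Longrightarrow> peval (g H) z = 0"
  using kernel by blast

text \<open>Every point is a multiple of \<open>a\<close> plus a point of \<open>H\<close>.
  Divisibility makes \<open>g K\<close> vanish on \<open>H\<close>, and both forms are 1 at
  \<open>a\<close>, so they coincide.\<close>

lemma dvd_imp_eq: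
  assumes "H \<in> A" "K \<in> A" "g H dvd g K"
  shows "H = K"
proof -
  have "peval (g K) z = peval (g H) z" for z
  proof -
    have "peval (g H) (z - peval (g H) z *s a) = 0"
      by (simp add: peval_form_diff peval_form_scale form peval_a assms)
    then have "peval (g K) (z - peval (g H) z *s a) = 0"
      using assms form_dvd_iff form nonzero by blast
    then show ?thesis by (simp add: peval_form_diff peval_form_scale form peval_a assms)
  qed
  then have "z \<in> H \<longleftrightarrow> z \<in> K" for z by (simp only: kernel assms)
  then show ?thesis by blast
qed

lemma axis_form_diff:
  assumes "H \<in> A" "K \<in> A" "H \<noteq> K"
  shows "axis_form a (H \<inter> K) (g H - g K)"
proof -
  have "g H \<noteq> g K" using dvd_imp_eq[of H K] assms by auto
  then show ?thesis
    using assms kernel[of H] kernel[of K]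
    by (simp add: axis_form_def forms_1_diff form peval_diff peval_a)
qed

lemma codim2_flatE:
  assumes "P \<in> codim2_flats A"
  obtains H K where "H \<in> A" "K \<in> A" "H \<noteq> K" "P = H \<inter> K" "axis_form a P (g H - g K)"
  using assms axis_form_diff unfolding codim2_flats_def by blast

text \<open>The space is spanned by \<open>a\<close>, \<open>P\<close> and one vector
  \<open>e\<close> at which \<open>g H - g K\<close> is 1, so a form vanishing at \<open>a\<close>
  and on \<open>P\<close> is determined by its value at \<open>e\<close>.\<close>

lemma form_multiple_of_axis_form:
  assumes P: "P \<in> codim2_flats A" and y: "axis_form a P y"
    and d: "d \<in> forms 1" "peval d a = 0" "\<forall>z\<in>P. peval d z = 0"
  shows "\<exists>c. d = Const c * y"
proof -
  obtain H K where HK: "H \<in> A" "K \<in> A" "P = H \<inter> K" "axis_form a P (g H - g K)"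
    using P by (rule codim2_flatE)
  let ?y0 = "g H - g K"
  have y0: "?y0 \<in> forms 1" "?y0 \<noteq> 0" using HK(4) by (auto simp: axis_form_def)
  obtain e where e: "peval ?y0 e = 1" using ex_peval_form_eq_1[OF y0] .
  have eq: "q = Const (peval q e) * ?y0"
    if q: "q \<in> forms 1" "peval q a = 0" "\<forall>z\<in>P. peval q z = 0" for q
  proof (rule peval_ext)
    fix z
    define w where "w = z - peval ?y0 z *s e"
    have "peval ?y0 w = 0"
      unfolding w_def by (simp add: peval_form_diff peval_form_scale y0 e)
    \<comment> \<open>Where \<open>g H\<close> and \<open>g K\<close> agree, subtracting their
      common value times \<open>a\<close> makes both vanish.\<close>
    then have "w - peval (g H) w *s a \<in> P"
      using HK by (simp add: peval_diff kernel peval_form_diff peval_form_scale form peval_a)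
    then have "peval q (w - peval (g H) w *s a) = 0" using q by blast
    then have "peval q w = 0" using q by (simp add: peval_form_diff peval_form_scale)
    then show "peval q z = peval (Const (peval q e) * ?y0) z"
      unfolding w_def using q by (simp add: peval_form_diff peval_form_scale peval_mult)
  qed
  have "y = Const (peval y e) * ?y0" using y by (intro eq) (auto simp: axis_form_def)
  moreover have "y \<noteq> 0" using y by (simp add: axis_form_def)
  ultimately have nz: "peval y e \<noteq> 0" by force
  have "Const (peval d e / peval y e) * y = Const (peval d e / peval y e) * (Const (peval y e) * ?y0)"
    using \<open>y = _\<close> by simp
  also have "\<dots> = Const (peval d e) * ?y0"
    using nz by (simp add: mult.assoc[symmetric] Const_mult[symmetric])
  finally show ?thesis using eq[OF d] by metis
qed

text \<open>Both forms are 1 at \<open>a\<close> and 0 on \<open>P\<close>, so their difference is a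
  multiple of \<open>y\<close>. The hyperplanes through \<open>P\<close> thus form a pencil with one
  scalar parameter \<open>b\<close>.\<close>

lemma form_through_flat:
  assumes P: "P \<in> codim2_flats A" "axis_form a P y"
    and "H \<in> A" "P \<subseteq> H" "K \<in> A" "P \<subseteq> K"
  shows "\<exists>b. g K = g H - Const b * y"
proof -
  have "\<exists>c. g H - g K = Const c * y"
    using assms
    by (intro form_multiple_of_axis_form P)
      (auto simp: forms_1_diff form peval_diff peval_a vanishes_on_subset[of _ P])
  then obtain c where "g H - g K = Const c * y" by blast
  then have "g K = g H - Const c * y" by (simp add: algebra_simps)
  then show ?thesis by blast
qed

text \<open>Some pair \<open>K\<close>, \<open>K'\<close> cuts out \<open>P\<close>, and both of
  their forms lie in the pencil \<open>g H - b y\<close>.\<close>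

lemma mem_flat_iff:
  assumes P: "P \<in> codim2_flats A" and y: "axis_form a P y" and H: "H \<in> A" "P \<subseteq> H"
  shows "z \<in> P \<longleftrightarrow> peval (g H) z = 0 \<and> peval y z = 0"
proof
  assume "z \<in> P"
  then show "peval (g H) z = 0 \<and> peval y z = 0"
    using H y vanishes_on_subset[of H P] by (simp add: axis_form_def)
next
  assume z: "peval (g H) z = 0 \<and> peval y z = 0"
  obtain K K' where K: "K \<in> A" "K' \<in> A" "P = K \<inter> K'" using P by (rule codim2_flatE)
  obtain b b' where "g K = g H - Const b * y" "g K' = g H - Const b' * y"
    using form_through_flat[OF P y H] K by (metis inf_le1 inf_le2)
  then show "z \<in> P" using K z by (simp add: kernel peval_diff peval_mult)
qed

lemma vanishing_on_flat_iff:
  assumes P: "P \<in> codim2_flats A" and y: "axis_form a P y" and H: "H \<in> A" "P \<subseteq> H"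
  shows "(\<forall>z\<in>P. peval p z = 0) \<longleftrightarrow> (\<exists>c d. p = c * g H + d * y)"
  using mem_ideal_of_two_forms_iff[of "g H" y a p] mem_flat_iff[OF assms] y H
  by (auto simp: axis_form_def form peval_a)

section \<open>Ideals and dimensions of the flats\<close>

lemma subspace_hyperplane:
  assumes "H \<in> A"
  shows "vec.subspace H"
proof -
  have "H = {z. peval (g H) z = 0}" using kernel[OF assms] by blast
  then show ?thesis using subspace_form_kernel[OF form[OF assms]] by simp
qed

lemma subspace_flat: "P \<in> codim2_flats A \<Longrightarrow> vec.subspace P"
  by (auto simp: codim2_flats_def intro: vec.subspace_inter subspace_hyperplane)

text \<open>All polynomials vanishing on \<open>P\<close> are generated by the two linear forms
  \<open>g H\<close> and \<open>g H - g K\<close>, so the restriction to homogeneous generators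
  loses nothing.\<close>

lemma homogeneous_ideal_eq:
  assumes P: "P \<in> codim2_flats A"
  shows "homogeneous_ideal P = {p. \<forall>z\<in>P. peval p z = 0}"
proof
  have "ideal.subspace {p :: ('a, 'n) mpoly. \<forall>z\<in>P. peval p z = 0}"
    by (auto simp: ideal.subspace_def peval_simps)
  then show "homogeneous_ideal P \<subseteq> {p. \<forall>z\<in>P. peval p z = 0}"
    unfolding homogeneous_ideal_def by (intro ideal.span_minimal) auto
  obtain H K where HK: "H \<in> A" "P = H \<inter> K" "axis_form a P (g H - g K)"
    using P by (rule codim2_flatE)
  have gen: "q \<in> homogeneous_ideal P" if "q \<in> forms 1" "\<forall>z\<in>P. peval q z = 0" for q
    unfolding homogeneous_ideal_def using that by (intro ideal.span_base) blast
  show "{p. \<forall>z\<in>P. peval p z = 0} \<subseteq> homogeneous_ideal P"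
  proof
    fix p assume "p \<in> {p. \<forall>z\<in>P. peval p z = 0}"
    then obtain c d where p: "p = c * g H + d * (g H - g K)"
      using vanishing_on_flat_iff[OF P HK(3,1)] HK(2) by auto
    have "g H \<in> homogeneous_ideal P"
      using HK vanishes_on_subset[of H P] by (intro gen) (auto simp: form)
    moreover have "g H - g K \<in> homogeneous_ideal P"
      using HK(3) by (intro gen) (auto simp: axis_form_def)
    ultimately show "p \<in> homogeneous_ideal P"
      unfolding p homogeneous_ideal_def by (intro ideal.span_add ideal.span_scale)
  qed
qed

lemma a_notin_flat:
  assumes "P \<in> codim2_flats A"
  shows "a \<notin> P"
proof -
  obtain H where "H \<in> A" "P \<subseteq> H" using assms by (auto elim!: codim2_flatE)
  then show ?thesis using kernel[of H a] peval_a[of H] by auto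
qed

text \<open>Moving a zero of \<open>y\<close> along \<open>a\<close> until \<open>g H\<close>
  vanishes lands in \<open>P\<close>.\<close>

lemma axis_form_kernel:
  assumes P: "P \<in> codim2_flats A" and y: "axis_form a P y"
  shows "{z. peval y z = 0} = vec.span (insert a P)"
proof
  obtain H where H: "H \<in> A" "P \<subseteq> H" using P by (auto elim!: codim2_flatE)
  have span_P: "vec.span P = P" using subspace_flat[OF P] by (simp only: vec.span_eq_iff)
  show "{z. peval y z = 0} \<subseteq> vec.span (insert a P)"
  proof
    fix z assume z: "z \<in> {z. peval y z = 0}"
    have "z - peval (g H) z *s a \<in> P"
      unfolding mem_flat_iff[OF P y H]
      using z y H by (simp add: peval_form_diff peval_form_scale form peval_a axis_form_def)
    then show "z \<in> vec.span (insert a P)" unfolding vec.span_breakdown_eq span_P by blast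
  qed
  show "vec.span (insert a P) \<subseteq> {z. peval y z = 0}"
    using y by (intro vec.span_minimal subspace_form_kernel) (auto simp: axis_form_def)
qed

lemma axis_formI:
  assumes "y \<in> forms 1" "y \<noteq> 0" "vec.span (insert a P) = {z. peval y z = 0}"
  shows "axis_form a P y"
proof -
  have "peval y z = 0" if "z \<in> insert a P" for z
    using vec.span_base[OF that] assms(3) by auto
  then show ?thesis using assms(1,2) by (simp add: axis_form_def)
qed

lemma ex_axis_form: "P \<in> codim2_flats A \<Longrightarrow> \<exists>y. axis_form a P y"
  by (auto elim!: codim2_flatE)

lemma proj_hyperplane_span:
  assumes P: "P \<in> codim2_flats A"
  shows "proj_hyperplane (vec.span (insert a P))"
proof -
  obtain y where y: "axis_form a P y" using ex_axis_form[OF P] by blast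
  then have "vec.dim {z. peval y z = 0} + 1 = CARD('n)"
    by (intro dim_form_kernel) (auto simp: axis_form_def)
  then show ?thesis by (simp add: proj_hyperplane_def axis_form_kernel[OF P y])
qed

lemma dim_flat:
  assumes P: "P \<in> codim2_flats A"
  shows "vec.dim P + 2 = CARD('n)"
proof -
  have span_P: "vec.span P = P" using subspace_flat[OF P] by (simp only: vec.span_eq_iff)
  have "vec.dim (insert a P) = vec.dim P + 1"
    unfolding vec.dim_insert span_P using a_notin_flat[OF P] by simp
  then show ?thesis using proj_hyperplane_span[OF P] by (simp add: proj_hyperplane_def)
qed

text \<open>All flats have the same dimension. Distinctness of the radicals and irredundancy rest on
  this.\<close>

lemma flat_subset_imp_eq:
  assumes "P \<in> codim2_flats A" "P' \<in> codim2_flats A" "P \<subseteq> P'"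
  shows "P = P'"
  using vec.subspace_dim_equal[OF subspace_flat[OF assms(1)] subspace_flat[OF assms(2)] assms(3)]
    dim_flat[OF assms(1)] dim_flat[OF assms(2)] by simp

lemma finite_flats: "finite (codim2_flats A)"
proof -
  have "codim2_flats A \<subseteq> (\<lambda>(H, K). H \<inter> K) ` (A \<times> A)" by (auto simp: codim2_flats_def)
  then show ?thesis using finite_A by (meson finite_SigmaI finite_imageI finite_subset)
qed

section \<open>The primary components\<close>

abbreviation flat_mult :: "('a ^ 'n) set \<Rightarrow> nat" where
  "flat_mult P \<equiv> hyperplanes_through A P"

text \<open>This keeps the exponent \<open>flat_mult P - 1\<close> positive, so that the components
  lie in the ideals of their flats.\<close>

lemma two_le_flat_mult:
  assumes "P \<in> codim2_flats A"
  shows "2 \<le> flat_mult P"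
proof -
  obtain H K where HK: "H \<in> A" "K \<in> A" "H \<noteq> K" "P = H \<inter> K" using assms by (rule codim2_flatE)
  have "card {H, K} \<le> card {H \<in> A. P \<subseteq> H}"
    using HK finite_A by (intro card_mono) auto
  then show ?thesis using HK by (simp add: hyperplanes_through_def)
qed

text \<open>The form \<open>y\<close> is a parameter because the join of \<open>P\<close> and
  \<open>a\<close> determines it only up to a scalar.\<close>

definition component :: "('a ^ 'n) set \<Rightarrow> ('a, 'n) mpoly \<Rightarrow> ('a, 'n) mpoly set" where
  "component P y = ideal.span (insert y (ideal_power (homogeneous_ideal P) (flat_mult P - 1)))"

text \<open>Modulo \<open>y\<close> the ideal of \<open>P\<close> is generated by \<open>g H\<close>
  alone, so its powers are generated by the powers of \<open>g H\<close>.\<close>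

lemma mem_axis_power_iff:
  assumes P: "P \<in> codim2_flats A" and y: "axis_form a P y" and H: "H \<in> A" "P \<subseteq> H"
  shows "p \<in> ideal.span (insert y (ideal_power (homogeneous_ideal P) k)) \<longleftrightarrow>
    (\<exists>c d. p = c * y + d * g H ^ k)"
proof -
  let ?I = "homogeneous_ideal P"
  have mem: "q \<in> ?I \<longleftrightarrow> (\<exists>c d. q = c * g H + d * y)" for q
    using vanishing_on_flat_iff[OF P y H] homogeneous_ideal_eq[OF P] by simp
  have g_mem: "g H \<in> ?I" unfolding mem by (rule exI[of _ 1], rule exI[of _ 0]) simp
  have power: "g H ^ k \<in> ideal_power ?I k" for k
  proof (induction k)
    case (Suc k)
    then show ?case using g_mem by (auto intro!: ideal.span_base)
  qed simp
  have sub: "ideal.subspace {p. \<exists>c d. p = c * y + d * g H ^ k}" for k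
  proof -
    have "{p. \<exists>c d. p = c * y + d * g H ^ k} = ideal.span {y, g H ^ k}"
      by (rule set_eqI) (simp only: mem_Collect_eq mem_ideal_span_pair)
    then show ?thesis by simp
  qed
  have le: "ideal_power ?I k \<subseteq> {p. \<exists>c d. p = c * y + d * g H ^ k}" for k
  proof (induction k)
    case 0
    have "p = 0 * y + p * g H ^ 0" for p by simp
    then show ?case by blast
  next
    case (Suc k)
    have "q * r \<in> {p. \<exists>c d. p = c * y + d * g H ^ Suc k}"
      if qI: "q \<in> ?I" and rI: "r \<in> ideal_power ?I k" for q r
    proof -
      obtain c d where q: "q = c * g H + d * y" using qI mem by blast
      obtain c' d' where r: "r = c' * y + d' * g H ^ k" using rI Suc by blast
      have "q * r = (c * g H * c' + d * r) * y + (c * d') * g H ^ Suc k"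
        unfolding q by (subst (2) r) (simp add: r algebra_simps)
      then show ?thesis by blast
    qed
    then show ?case unfolding ideal_power.simps by (intro ideal.span_minimal sub) auto
  qed
  show ?thesis
  proof
    assume "p \<in> ideal.span (insert y (ideal_power ?I k))"
    moreover have "y = 1 * y + 0 * g H ^ k" by simp
    then have "y \<in> {p. \<exists>c d. p = c * y + d * g H ^ k}" by blast
    ultimately have "p \<in> {p. \<exists>c d. p = c * y + d * g H ^ k}"
      using ideal.span_minimal[OF _ sub, of "insert y (ideal_power ?I k)" k] le by blast
    then show "\<exists>c d. p = c * y + d * g H ^ k" by simp
  next
    assume "\<exists>c d. p = c * y + d * g H ^ k"
    then obtain c d where "p = c * y + d * g H ^ k" by blast
    then show "p \<in> ideal.span (insert y (ideal_power ?I k))"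
      using power by (auto intro!: ideal.span_add ideal.span_scale intro: ideal.span_base)
  qed
qed

lemma mem_component_iff:
  assumes "P \<in> codim2_flats A" "axis_form a P y" "H \<in> A" "P \<subseteq> H"
  shows "p \<in> component P y \<longleftrightarrow> (\<exists>c d. p = c * y + d * g H ^ (flat_mult P - 1))"
  unfolding component_def using assms by (rule mem_axis_power_iff)

lemma component_subset:
  assumes P: "P \<in> codim2_flats A" "axis_form a P y"
  shows "component P y \<subseteq> homogeneous_ideal P"
proof
  fix p assume p: "p \<in> component P y"
  obtain H where H: "H \<in> A" "P \<subseteq> H" using P(1) by (auto elim!: codim2_flatE)
  obtain c d where "p = c * y + d * g H ^ (flat_mult P - 1)"
    using p mem_component_iff[OF P H] by blast
  moreover have "flat_mult P - 1 > 0" using two_le_flat_mult[OF P(1)] by simp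
  ultimately show "p \<in> homogeneous_ideal P"
    using P(2) vanishes_on_subset[OF H]
    by (auto simp: homogeneous_ideal_eq[OF P(1)] peval_simps axis_form_def power_0_left)
qed

text \<open>Allowing any large \<open>N\<close> lets one exponent serve all flats when the radical
  of the residual is computed.\<close>

lemma power_mem_component:
  assumes P: "P \<in> codim2_flats A" "axis_form a P y" and p: "p \<in> homogeneous_ideal P"
    and "flat_mult P - 1 \<le> N"
  shows "p ^ N \<in> component P y"
proof -
  obtain H where H: "H \<in> A" "P \<subseteq> H" using P(1) by (auto elim!: codim2_flatE)
  have "p ^ k \<in> ideal_power (homogeneous_ideal P) k" for k
  proof (induction k)
    case (Suc k)
    then show ?case using p by (auto intro!: ideal.span_base)
  qed simp
  then have "p ^ (flat_mult P - 1) \<in> component P y"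
    unfolding component_def by (intro ideal.span_base) blast
  then have "p ^ (N - (flat_mult P - 1)) * p ^ (flat_mult P - 1) \<in> component P y"
    unfolding component_def by (rule ideal.span_scale)
  then show ?thesis using assms(4) by (simp add: power_add[symmetric])
qed

lemma radical_component:
  assumes "P \<in> codim2_flats A" "axis_form a P y"
  shows "ideal_radical (component P y) = homogeneous_ideal P"
proof
  show "ideal_radical (component P y) \<subseteq> homogeneous_ideal P"
  proof
    fix p assume "p \<in> ideal_radical (component P y)"
    then obtain k where "p ^ k \<in> homogeneous_ideal P"
      using component_subset[OF assms] by (auto simp: ideal_radical_def)
    then show "p \<in> homogeneous_ideal P"
      by (auto simp: homogeneous_ideal_eq[OF assms(1)] peval_power)
  qed
  show "homogeneous_ideal P \<subseteq> ideal_radical (component P y)"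
    using power_mem_component[OF assms _ order_refl] by (auto simp: ideal_radical_def)
qed

lemma homogeneous_ideal_prime:
  assumes P: "P \<in> codim2_flats A" and "p * q \<in> homogeneous_ideal P"
  shows "p \<in> homogeneous_ideal P \<or> q \<in> homogeneous_ideal P"
  using vanishing_on_subspace_prime[OF subspace_flat[OF P], of p q] assms(2)
  by (simp add: homogeneous_ideal_eq[OF P])

lemma one_notin_homogeneous_ideal: "P \<in> codim2_flats A \<Longrightarrow> 1 \<notin> homogeneous_ideal P"
  using vec.subspace_0[OF subspace_flat] by (auto simp: homogeneous_ideal_eq)

text \<open>At \<open>a\<close> the form \<open>y\<close> is 0 and \<open>g H\<close> is 1. If
  \<open>g H\<close> divided \<open>y\<close>, then \<open>y\<close> would vanish on
  \<open>H\<close> and at \<open>a\<close>, which span the space.\<close>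

lemma axis_form_facts:
  assumes "axis_form a P y" "H \<in> A"
  shows "prime_elem y" "\<not> y dvd g H" "P \<in> codim2_flats A \<Longrightarrow> P \<subseteq> H \<Longrightarrow> \<not> g H dvd y"
proof -
  have y: "y \<in> forms 1" "y \<noteq> 0" "peval y a = 0" using assms(1) by (auto simp: axis_form_def)
  show "prime_elem y" using y by (intro prime_elem_form)
  show "\<not> y dvd g H" using y peval_a[OF assms(2)] by (auto simp: form_dvd_iff)
  assume P: "P \<in> codim2_flats A" "P \<subseteq> H"
  show "\<not> g H dvd y"
  proof
    assume dvd: "g H dvd y"
    have "peval y z = 0" for z
    proof -
      have "peval (g H) (z - peval (g H) z *s a) = 0"
        by (simp add: peval_form_diff peval_form_scale form peval_a assms(2))
      then have "peval y (z - peval (g H) z *s a) = 0"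
        using dvd form_dvd_iff[OF form[OF assms(2)] nonzero[OF assms(2)]] by blast
      then show ?thesis by (simp add: peval_form_diff peval_form_scale y)
    qed
    then show False using y peval_eq_0_imp by blast
  qed
qed

text \<open>If \<open>p q\<close> lies in \<open>(y, x\<^sup>k)\<close> and \<open>q\<close> does not vanish on \<open>P\<close>, the exponent \<open>j\<close> with
  \<open>p \<in> (y, x\<^sup>j)\<close> can be raised up to \<open>k\<close>.\<close>

lemma primary_component:
  assumes P: "P \<in> codim2_flats A" "axis_form a P y"
  shows "primary_ideal (component P y)"
  unfolding primary_ideal_def
proof (intro conjI allI impI)
  show "ideal.subspace (component P y)" by (simp add: component_def)
  show "component P y \<noteq> UNIV"
    using component_subset[OF P] one_notin_homogeneous_ideal[OF P(1)] by blast
  obtain H where H: "H \<in> A" "P \<subseteq> H" using P(1) by (auto elim!: codim2_flatE)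
  note y = axis_form_facts[OF P(2) H(1)]
  fix p q assume pq: "p * q \<in> component P y"
  define k where "k = flat_mult P - 1"
  obtain c d where cd: "p * q = c * y + d * g H ^ k"
    using pq unfolding mem_component_iff[OF P H] k_def by blast
  show "p \<in> component P y \<or> (\<exists>k. q ^ k \<in> component P y)"
  proof (cases "q \<in> homogeneous_ideal P")
    case True
    then show ?thesis using power_mem_component[OF P True order_refl] by blast
  next
    case False
    have "\<exists>u v. p = u * y + v * g H ^ j" if "j \<le> k" for j
      using that
    proof (induction j)
      case 0
      have "p = 0 * y + p * g H ^ 0" by simp
      then show ?case by blast
    next
      case (Suc j)
      then obtain u v where uv: "p = u * y + v * g H ^ j" by auto
      \<comment> \<open>The two expressions for \<open>p * q\<close> agree modulo \<open>y\<close>,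
        where \<open>g H ^ j\<close> can be cancelled.\<close>
      have "g H ^ k = g H ^ j * g H ^ (k - j)" using Suc.prems by (simp add: power_add[symmetric])
      then have "g H ^ j * (v * q - d * g H ^ (k - j)) = y * (c - u * q)"
        using cd unfolding uv by (simp add: algebra_simps)
      then have "y dvd g H ^ j * (v * q - d * g H ^ (k - j))" by simp
      then have "y dvd v * q - d * g H ^ (k - j)"
        using y(1,2) prime_elem_dvd_multD prime_elem_dvd_power by blast
      then obtain s where s: "v * q - d * g H ^ (k - j) = y * s" by (rule dvdE)
      have "g H ^ (k - j) = g H * g H ^ (k - Suc j)"
        using Suc.prems by (simp add: power_Suc[symmetric] Suc_diff_Suc del: power_Suc)
      then have "v * q = (d * g H ^ (k - Suc j)) * g H + s * y"
        using s by (simp add: algebra_simps)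
      \<comment> \<open>As \<open>j < k\<close>, a factor \<open>g H\<close> is left over, so
        \<open>v * q\<close> vanishes on \<open>P\<close>. Since \<open>q\<close> does not,
        \<open>v\<close> does and supplies the next power of \<open>g H\<close>.\<close>
      then have "v * q \<in> homogeneous_ideal P"
        unfolding homogeneous_ideal_eq[OF P(1)] using vanishing_on_flat_iff[OF P H, of "v * q"] by blast
      then have "v \<in> homogeneous_ideal P" using homogeneous_ideal_prime[OF P(1)] False by blast
      then obtain s t where "v = s * g H + t * y"
        unfolding homogeneous_ideal_eq[OF P(1)] using vanishing_on_flat_iff[OF P H, of v] by blast
      then have "p = (u + t * g H ^ j) * y + s * g H ^ Suc j" using uv by (simp add: algebra_simps)
      then show ?case by blast
    qed
    from this[of k] show ?thesis unfolding mem_component_iff[OF P H] k_def by blast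
  qed
qed

end

section \<open>The residual as an interpolation problem\<close>

text \<open>A colon by an ideal need only be tested on its generators, here the partial
  derivatives.\<close>

lemma mem_residual_iff:
  "p \<in> residual f l \<longleftrightarrow> (\<forall>i. \<exists>c d. p * partial_deriv i f = c * f + d * form_deriv l f)"
proof -
  let ?I = "ideal.span {f, form_deriv l f}"
  have "ideal.subspace {q. p * q \<in> ?I}"
    by (auto simp: ideal.subspace_def distrib_left mult.left_commute[of p]
        intro: ideal.span_add ideal.span_scale ideal.span_zero)
  then have "(\<forall>i. p * partial_deriv i f \<in> ?I) \<Longrightarrow> jacobian_ideal f \<subseteq> {q. p * q \<in> ?I}"
    unfolding jacobian_ideal_def by (intro ideal.span_minimal) auto
  moreover have "partial_deriv i f \<in> jacobian_ideal f" for i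
    unfolding jacobian_ideal_def by (intro ideal.span_base) simp
  ultimately have "p \<in> residual f l \<longleftrightarrow> (\<forall>i. p * partial_deriv i f \<in> ?I)"
    unfolding residual_def ideal_colon_def by blast
  then show ?thesis by (simp only: mem_ideal_span_pair)
qed

text \<open>The polynomial and all its derivatives scale by the same unit, so every relation between
  them persists. This permits the passage to normalized forms.\<close>

lemma residual_Const_mult:
  fixes f :: "('a::field, 'n::finite) mpoly"
  assumes "c \<noteq> 0"
  shows "residual (Const c * f) l = residual f l"
proof (rule set_eqI)
  fix p
  have cancel: "Const c * q = Const c * r \<longleftrightarrow> q = r" for q r :: "('a, 'n) mpoly"
  proof
    assume "Const c * q = Const c * r"
    then have "Const (1 / c) * Const c * q = Const (1 / c) * Const c * r"
      by (simp only: mult.assoc)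
    then show "q = r" using assms by (simp add: Const_mult[symmetric])
  qed simp
  have "p * partial_deriv i (Const c * f) = u * (Const c * f) + v * form_deriv l (Const c * f) \<longleftrightarrow>
      p * partial_deriv i f = u * f + v * form_deriv l f" for i u v
    by (subst cancel[symmetric]) (simp add: partial_deriv_mult form_deriv_mult algebra_simps)
  then show "p \<in> residual (Const c * f) l \<longleftrightarrow> p \<in> residual f l"
    by (simp only: mem_residual_iff)
qed

context normalized_arrangement
begin

text \<open>Modulo \<open>g H\<close> a derivative of \<open>f = \<Prod> g H\<close> is that of \<open>g H\<close> times the cofactor \<open>f / g H\<close>, which
  cancels.\<close>

lemma mem_residual_iff_interpolation:
  assumes "dual_vec l = a"
  shows "p \<in> residual (\<Prod>H\<in>A. g H) l \<longleftrightarrow>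
    (\<forall>i. \<exists>u. \<forall>H\<in>A. g H dvd u - Const (dual_vec (g H) $ i) * p)"
proof -
  define f where "f = (\<Prod>H\<in>A. g H)"
  define cof where "cof H = (\<Prod>K\<in>A - {H}. g K)" for H
  have f: "f = g H * cof H" if "H \<in> A" for H
    unfolding f_def cof_def using finite_A that by (rule prod.remove)
  have cof: "\<not> g H dvd cof H" if H: "H \<in> A" for H
  proof
    assume "g H dvd cof H"
    then obtain K where "K \<in> A - {H}" "g H dvd g K"
      using prime_elem_dvd_prodD[OF prime[OF H], of g "A - {H}"] finite_A unfolding cof_def by blast
    then show False using dvd_imp_eq[OF H] by blast
  qed
  have partial: "partial_deriv i f = Const (dual_vec (g H) $ i) * cof H + g H * partial_deriv i (cof H)"
    if "H \<in> A" for H i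
    by (simp add: f[OF that] partial_deriv_mult partial_deriv_form[OF form[OF that]])
  \<comment> \<open>The cofactor has coefficient 1 because \<open>g H\<close> is 1 at the dual point
    of \<open>l\<close>.\<close>
  have directional: "form_deriv l f = cof H + g H * form_deriv l (cof H)" if "H \<in> A" for H
    by (simp add: f[OF that] form_deriv_mult form_deriv_form[OF form[OF that]] assms peval_a[OF that])
  have key: "(\<exists>c d. p * partial_deriv i f = c * f + d * form_deriv l f) \<longleftrightarrow>
      (\<exists>u. \<forall>H\<in>A. g H dvd u - Const (dual_vec (g H) $ i) * p)" for i
  proof
    assume "\<exists>c d. p * partial_deriv i f = c * f + d * form_deriv l f"
    then obtain c d where cd: "p * partial_deriv i f = c * f + d * form_deriv l f" by blast
    \<comment> \<open>The coefficient \<open>d\<close> of the directional derivative is the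
      interpolant.\<close>
    have "g H dvd d - Const (dual_vec (g H) $ i) * p" if H: "H \<in> A" for H
    proof -
      have "cof H * (d - Const (dual_vec (g H) $ i) * p) =
          g H * (p * partial_deriv i (cof H) - c * cof H - d * form_deriv l (cof H))"
        using cd unfolding partial[OF H] directional[OF H] by (subst (asm) f[OF H]) (simp add: algebra_simps)
      then have "g H dvd cof H * (d - Const (dual_vec (g H) $ i) * p)" by simp
      then show ?thesis using prime_elem_dvd_multD[OF prime[OF H]] cof[OF H] by blast
    qed
    then show "\<exists>u. \<forall>H\<in>A. g H dvd u - Const (dual_vec (g H) $ i) * p" by blast
  next
    assume "\<exists>u. \<forall>H\<in>A. g H dvd u - Const (dual_vec (g H) $ i) * p"
    then obtain u where u: "\<forall>H\<in>A. g H dvd u - Const (dual_vec (g H) $ i) * p" by blast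
    have "g H dvd p * partial_deriv i f - u * form_deriv l f" if H: "H \<in> A" for H
    proof -
      obtain v where "u - Const (dual_vec (g H) $ i) * p = g H * v" using u H by (auto elim: dvdE)
      then have v: "u = Const (dual_vec (g H) $ i) * p + g H * v" by (simp add: algebra_simps)
      have "p * partial_deriv i f - u * form_deriv l f =
          g H * (p * partial_deriv i (cof H) - v * cof H - u * form_deriv l (cof H))"
        unfolding partial[OF H] directional[OF H] by (subst (1) v) (simp add: v algebra_simps)
      then show ?thesis by simp
    qed
    then have "f dvd p * partial_deriv i f - u * form_deriv l f"
      unfolding f_def using finite_A prime dvd_imp_eq by (intro prod_of_primes_dvd) auto
    then obtain v where "p * partial_deriv i f - u * form_deriv l f = f * v" by (rule dvdE)
    then have "p * partial_deriv i f = v * f + u * form_deriv l f" by (simp add: algebra_simps)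
    then show "\<exists>c d. p * partial_deriv i f = c * f + d * form_deriv l f" by blast
  qed
  show ?thesis unfolding mem_residual_iff f_def[symmetric] by (simp only: key)
qed

text \<open>Since \<open>b y \<equiv> x\<close> modulo \<open>g K = x - b y\<close>, the congruences for \<open>u\<close> at the hyperplanes through \<open>P\<close>
  combine into a divisibility that no longer mentions \<open>b\<close>.\<close>

lemma interpolation_at_flat:
  assumes P: "P \<in> codim2_flats A" "axis_form a P y" and H: "H \<in> A" "P \<subseteq> H" and K: "K \<in> A" "P \<subseteq> K"
    and u: "g K dvd u - Const (dual_vec (g K) $ i) * p"
  shows "g K dvd y * (u - Const (dual_vec (g H) $ i) * p) + Const (dual_vec y $ i) * p * g H"
proof -
  obtain b where b: "g K = g H - Const b * y" using form_through_flat[OF P H K] by blast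
  have "y \<in> forms 1" using P(2) by (simp add: axis_form_def)
  then have c: "Const (dual_vec (g K) $ i) = Const (dual_vec (g H) $ i) - Const b * Const (dual_vec y $ i)"
    by (simp add: b dual_vec_diff dual_vec_Const_mult single_diff Const_mult)
  have "y * (u - Const (dual_vec (g H) $ i) * p) + Const (dual_vec y $ i) * p * g H =
      y * (u - Const (dual_vec (g K) $ i) * p) + g K * (Const (dual_vec y $ i) * p)"
    unfolding c unfolding b by (simp add: algebra_simps)
  then show ?thesis using u by simp
qed

text \<open>Let \<open>x = g H\<close>. The product of all forms through \<open>P\<close> divides
  \<open>y * u' + Const k * p * x\<close> and is a power of \<open>x\<close> modulo
  \<open>y\<close>. Cancelling one \<open>x\<close> lowers the exponent to
  \<open>flat_mult P - 1\<close>; a coordinate \<open>i\<close> where \<open>y\<close> has a nonzero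
  coefficient makes \<open>k\<close> invertible.\<close>

lemma interpolation_imp_mem_component:
  assumes P: "P \<in> codim2_flats A" "axis_form a P y"
    and interp: "\<forall>i. \<exists>u. \<forall>H\<in>A. g H dvd u - Const (dual_vec (g H) $ i) * p"
  shows "p \<in> component P y"
proof -
  obtain H where H: "H \<in> A" "P \<subseteq> H" using P(1) by (auto elim!: codim2_flatE)
  note y = axis_form_facts[OF P(2) H(1)]
  have "dual_vec y \<noteq> 0"
  proof
    assume "dual_vec y = 0"
    then have "y = linear_form 0" using P(2) forms_1_eq_linear_form by (metis axis_form_def)
    then show False using P(2) by (simp add: linear_form_def axis_form_def)
  qed
  then obtain i where i: "dual_vec y $ i \<noteq> 0" by (auto simp: vec_eq_iff)
  define k where "k = dual_vec y $ i"
  obtain u where u: "\<forall>H\<in>A. g H dvd u - Const (dual_vec (g H) $ i) * p" using interp by blast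
  define u' where "u' = u - Const (dual_vec (g H) $ i) * p"
  define L where "L = {K \<in> A. P \<subseteq> K}"
  have "\<forall>K\<in>L. \<exists>b. g K = g H - Const b * y"
    by (intro ballI form_through_flat[OF P H]) (auto simp: L_def)
  then obtain b where b: "\<forall>K\<in>L. g K = g H - Const (b K) * y" by metis
  have "(\<Prod>K\<in>L. g K) dvd y * u' + Const k * p * g H"
  proof (rule prod_of_primes_dvd)
    show "g K dvd y * u' + Const k * p * g H" if "K \<in> L" for K
      using interpolation_at_flat[OF P H] u that unfolding L_def u'_def k_def by blast
  qed (use finite_A prime dvd_imp_eq in \<open>auto simp: L_def\<close>)
  then obtain w where w: "y * u' + Const k * p * g H = (\<Prod>K\<in>L. g K) * w" by (rule dvdE)
  obtain s where s: "(\<Prod>K\<in>L. g H - Const (b K) * y) = g H ^ card L + y * s"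
    using prod_congruence_mod_y[of "g H" "\<lambda>K. Const (b K)" y L] by blast
  have "(\<Prod>K\<in>L. g K) = (\<Prod>K\<in>L. g H - Const (b K) * y)" by (rule prod.cong) (use b in auto)
  then have prod: "(\<Prod>K\<in>L. g K) = g H ^ card L + y * s" using s by simp
  define t where "t = flat_mult P - 1"
  have "card L = Suc t" using two_le_flat_mult[OF P(1)] by (simp add: t_def L_def hyperplanes_through_def)
  then have "g H * (Const k * p - g H ^ t * w) = y * (s * w - u')"
    using w unfolding prod by (simp add: algebra_simps)
  then have "y dvd g H * (Const k * p - g H ^ t * w)" by simp
  then have "y dvd Const k * p - g H ^ t * w" using y(1,2) prime_elem_dvd_multD by blast
  then obtain v where "Const k * p - g H ^ t * w = y * v" by (rule dvdE)
  then have v: "Const k * p = y * v + g H ^ t * w" by (simp add: algebra_simps)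
  have "p = Const (1 / k) * (Const k * p)"
    using i by (simp add: mult.assoc[symmetric] Const_mult[symmetric] k_def)
  also have "\<dots> = (Const (1 / k) * v) * y + (Const (1 / k) * w) * g H ^ t"
    unfolding v by (simp add: algebra_simps)
  finally show ?thesis unfolding mem_component_iff[OF P H] t_def by blast
qed

text \<open>The hyperplanes \<open>K \<in> L\<close> are split off one at a time; at each step the remaining factor vanishes on
  \<open>H \<inter> K\<close> because the other forms are prime to the ideal of that flat.\<close>

lemma product_divides_modulo:
  assumes H: "H \<in> A" and B: "B \<subseteq> A" "H \<notin> B"
    and local: "\<And>K. K \<in> B \<Longrightarrow> \<exists>y w. axis_form a (H \<inter> K) y \<and>
        g H dvd q - y ^ card {K' \<in> B. H \<inter> K \<subseteq> K'} * w"
    and L: "L \<subseteq> B"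
  shows "\<exists>w. g H dvd q - (\<Prod>K\<in>L. g K) * w"
proof -
  have "finite L" "finite B" using finite_A B(1) L by (meson finite_subset)+
  from this(1) L show ?thesis
  proof (induction L rule: finite_induct)
    case empty
    have "g H dvd q - (\<Prod>K\<in>{}. g K) * q" by simp
    then show ?case by blast
  next
    case (insert J L)
    then obtain w where w: "g H dvd q - (\<Prod>K\<in>L. g K) * w" by auto
    have J: "J \<in> A" "J \<noteq> H" "J \<in> B" using insert.prems B by auto
    define P where "P = H \<inter> J"
    have P: "P \<in> codim2_flats A" "P \<subseteq> H" "P \<subseteq> J"
      using H J by (auto simp: P_def codim2_flats_def)
    define M where "M = {K \<in> L. P \<subseteq> K}"
    define s where "s = card {K \<in> B. P \<subseteq> K}"
    obtain y v where y: "axis_form a P y" and v: "g H dvd q - y ^ s * v"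
      using local[OF J(3)] unfolding P_def s_def by blast
    note yf = axis_form_facts[OF y H]
    \<comment> \<open>The hyperplane \<open>J\<close> passes through \<open>P\<close> but is not in
      \<open>L\<close>, so at least one factor \<open>y\<close> survives the cancellation
      below.\<close>
    have "card (insert J M) \<le> s"
      unfolding s_def M_def using \<open>finite B\<close> insert.prems P(3) by (intro card_mono) auto
    moreover have "finite M" "J \<notin> M" using insert.hyps by (simp_all add: M_def)
    ultimately have less: "card M < s" by simp
    have "\<forall>K\<in>M. \<exists>b. g K = g H - Const b * y"
      by (intro ballI form_through_flat[OF P(1) y H P(2)]) (use insert.prems B in \<open>auto simp: M_def\<close>)
    then obtain b where b: "\<forall>K\<in>M. g K = g H - Const (b K) * y" by metis
    \<comment> \<open>Parameter 0 in the pencil belongs to \<open>H\<close>, which is not in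
      \<open>B\<close>; so the constant in the reduction modulo \<open>g H\<close> is
      nonzero.\<close>
    have "b K \<noteq> 0" if "K \<in> M" for K
    proof
      assume "b K = 0"
      then have "g K = g H" using b that by simp
      moreover have "K \<in> B" using that insert.prems by (auto simp: M_def)
      ultimately show False using dvd_imp_eq[of H K] H B by auto
    qed
    then have beta: "(\<Prod>K\<in>M. - b K) \<noteq> 0" using \<open>finite M\<close> by simp
    define \<beta> where "\<beta> = (\<Prod>K\<in>M. - b K)"
    define R where "R = (\<Prod>K\<in>L - M. g K)"
    have "(\<Prod>K\<in>M. g K) = (\<Prod>K\<in>M. g H - Const (b K) * y)" by (rule prod.cong) (use b in auto)
    then obtain r where r: "(\<Prod>K\<in>M. g K) = Const \<beta> * y ^ card M + g H * r"
      using prod_congruence_mod_x[of "g H" b y M] unfolding \<beta>_def by auto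
    have "M \<subseteq> L" by (auto simp: M_def)
    then have split: "(\<Prod>K\<in>L. g K) = R * (\<Prod>K\<in>M. g K)"
      unfolding R_def using insert.hyps(1) by (intro prod.subset_diff)
    have "y ^ s = y ^ card M * y ^ (s - card M)" using less by (simp add: power_add[symmetric])
    \<comment> \<open>The two congruences for \<open>q\<close> modulo \<open>g H\<close> are
      compared; \<open>y ^ card M\<close> can be cancelled, as \<open>g H\<close> is a prime not
      dividing \<open>y\<close>.\<close>
    then have "y ^ card M * (Const \<beta> * R * w - y ^ (s - card M) * v) =
        (q - y ^ s * v) - (q - (\<Prod>K\<in>L. g K) * w) - g H * (r * R * w)"
      unfolding split r by (simp add: algebra_simps)
    then have "g H dvd y ^ card M * (Const \<beta> * R * w - y ^ (s - card M) * v)"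
      using v w by (metis dvd_diff dvd_triv_left)
    then have dvd: "g H dvd Const \<beta> * R * w - y ^ (s - card M) * v"
      using yf(3)[OF P(1,2)] prime[OF H] prime_elem_dvd_multD prime_elem_dvd_power by blast
    have "Const \<beta> * R * w \<in> homogeneous_ideal P"
      unfolding homogeneous_ideal_eq[OF P(1)]
    proof (intro CollectI ballI)
      fix z assume z: "z \<in> P"
      then have "peval (g H) z = 0" "peval y z = 0"
        using P(2) vanishes_on_subset[OF H] y by (auto simp: axis_form_def)
      moreover from this have "peval (Const \<beta> * R * w - y ^ (s - card M) * v) z = 0"
        using dvd by (auto simp: peval_mult elim!: dvdE)
      ultimately show "peval (Const \<beta> * R * w) z = 0"
        using less by (simp add: peval_diff peval_mult peval_power power_0_left)
    qed
    moreover have "Const \<beta> \<notin> homogeneous_ideal P"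
      using beta vec.subspace_0[OF subspace_flat[OF P(1)]]
      by (auto simp: homogeneous_ideal_eq[OF P(1)] \<beta>_def)
    moreover have "R \<notin> homogeneous_ideal P"
    proof -
      have "(\<Prod>K\<in>N. g K) \<notin> homogeneous_ideal P" if "finite N" "N \<subseteq> L - M" for N
        using that
      proof (induction N rule: finite_induct)
        case empty
        then show ?case using one_notin_homogeneous_ideal[OF P(1)] by simp
      next
        case (insert K N)
        have "K \<in> A" "\<not> P \<subseteq> K" using insert.prems \<open>insert J L \<subseteq> B\<close> B(1) by (auto simp: M_def)
        then have "g K \<notin> homogeneous_ideal P"
          using kernel[of K] by (auto simp: homogeneous_ideal_eq[OF P(1)])
        then show ?case using insert homogeneous_ideal_prime[OF P(1)] by auto
      qed
      then show ?thesis unfolding R_def using insert.hyps(1) by blast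
    qed
    ultimately have "w \<in> homogeneous_ideal P"
      using homogeneous_ideal_prime[OF P(1)] by blast
    then have "\<forall>z\<in>P. peval w z = 0" by (simp add: homogeneous_ideal_eq[OF P(1)])
    \<comment> \<open>Modulo \<open>g H\<close> this says that \<open>w\<close> is
      \<open>(c - d) * g J\<close>, which extends the product by \<open>g J\<close>.\<close>
    then obtain c d where cd: "w = c * g J + d * (g H - g J)"
      using vanishing_on_flat_iff[OF P(1) axis_form_diff[OF H J(1) J(2)[symmetric], folded P_def] J(1) P(3)]
      by blast
    have "(\<Prod>K\<in>insert J L. g K) = g J * (\<Prod>K\<in>L. g K)" using insert.hyps by simp
    then have "q - (\<Prod>K\<in>insert J L. g K) * (c - d) =
        (q - (\<Prod>K\<in>L. g K) * w) + g H * ((\<Prod>K\<in>L. g K) * d)"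
      unfolding cd by (simp add: algebra_simps)
    then have "g H dvd q - (\<Prod>K\<in>insert J L. g K) * (c - d)"
      using dvd_add[OF w, of "g H * ((\<Prod>K\<in>L. g K) * d)"] by (simp only: dvd_triv_left)
    then show ?case by blast
  qed
qed

text \<open>A solution for \<open>B\<close> is corrected by a multiple of the product of its forms.
  This preserves the old congruences, and the multiplier is chosen to satisfy the one at the new
  \<open>H\<close>.\<close>

lemma mem_components_imp_interpolation:
  assumes y: "\<forall>P\<in>codim2_flats A. axis_form a P (y P)"
    and p: "\<forall>P\<in>codim2_flats A. p \<in> component P (y P)"
  shows "\<exists>u. \<forall>H\<in>A. g H dvd u - Const (dual_vec (g H) $ i) * p"
proof -
  have "\<exists>u. \<forall>H\<in>B. g H dvd u - Const (dual_vec (g H) $ i) * p" if "finite B" "B \<subseteq> A" for B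
    using that
  proof (induction B rule: finite_induct)
    case (insert H B)
    then obtain u where u: "\<forall>H\<in>B. g H dvd u - Const (dual_vec (g H) $ i) * p" by auto
    have H: "H \<in> A" "H \<notin> B" and B: "B \<subseteq> A" using insert by auto
    define q where "q = u - Const (dual_vec (g H) $ i) * p"
    have "\<exists>y w. axis_form a (H \<inter> K) y \<and> g H dvd q - y ^ card {K' \<in> B. H \<inter> K \<subseteq> K'} * w"
      if K: "K \<in> B" for K
    proof -
      define P where "P = H \<inter> K"
      have P: "P \<in> codim2_flats A" "P \<subseteq> H" using H B K by (auto simp: P_def codim2_flats_def)
      note yP = bspec[OF y P(1)]
      note yf = axis_form_facts[OF yP H(1)]
      define L where "L = {K' \<in> B. P \<subseteq> K'}"
      have L: "finite L" "L \<subseteq> A" using insert.hyps B by (auto simp: L_def)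
      \<comment> \<open>The new \<open>H\<close> passes through \<open>P\<close> and is not in
        \<open>B\<close>, so at most \<open>flat_mult P - 1\<close> earlier hyperplanes contain
        \<open>P\<close>: exactly the exponent of the component.\<close>
      have "card (insert H L) \<le> flat_mult P"
        unfolding hyperplanes_through_def using finite_A L H P by (intro card_mono) (auto simp: L_def)
      then have less: "card L \<le> flat_mult P - 1" using L H by (simp add: L_def)
      obtain c d where cd: "p = c * y P + d * g H ^ (flat_mult P - 1)"
        using p P(1) mem_component_iff[OF P(1) yP H(1) P(2)] by blast
      have "g H ^ (flat_mult P - 1) = g H ^ card L * g H ^ (flat_mult P - 1 - card L)"
        using less by (metis power_add le_add_diff_inverse)
      then have p_eq: "p = y P * c + g H ^ card L * (d * g H ^ (flat_mult P - 1 - card L))"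
        using cd by (simp add: algebra_simps)
      have "\<forall>K'\<in>L. \<exists>b. g K' = g H - Const b * y P"
        by (intro ballI form_through_flat[OF P(1) yP H(1) P(2)]) (use B in \<open>auto simp: L_def\<close>)
      then obtain b where b: "\<forall>K'\<in>L. g K' = g H - Const (b K') * y P" by metis
      have "\<exists>w. g H dvd q - y P ^ card L * w"
      proof (rule interpolant_mod_axis_power[OF L(1) prime[OF H(1)] yf(3)[OF P] yf(1,2) _ _ _ p_eq])
        show "prime_elem (g H - Const (b K') * y P)" if "K' \<in> L" for K'
          using prime[of K'] b that L by auto
        show "K1 = K2" if "K1 \<in> L" "K2 \<in> L"
          "g H - Const (b K1) * y P dvd g H - Const (b K2) * y P" for K1 K2
          using dvd_imp_eq[of K1 K2] b that L by auto
        show "g H - Const (b K') * y P dvd y P * q + Const (dual_vec (y P) $ i) * p * g H"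
          if K': "K' \<in> L" for K'
        proof -
          have "g K' dvd y P * q + Const (dual_vec (y P) $ i) * p * g H"
            unfolding q_def using K' L u
            by (intro interpolation_at_flat[OF P(1) yP H(1) P(2)]) (auto simp: L_def)
          then show ?thesis using b K' by simp
        qed
      qed
      then show ?thesis using yP unfolding P_def L_def by blast
    qed
    then obtain w where w: "g H dvd q - (\<Prod>K\<in>B. g K) * w"
      using product_divides_modulo[OF H(1) B H(2) _ order_refl] by blast
    define u' where "u' = u - (\<Prod>K\<in>B. g K) * w"
    have "g K dvd u' - Const (dual_vec (g K) $ i) * p" if "K \<in> insert H B" for K
    proof (cases "K = H")
      case True
      then show ?thesis using w by (simp add: u'_def q_def algebra_simps)
    next
      case False
      then have "K \<in> B" using that by simp
      then have "g K dvd (\<Prod>K\<in>B. g K) * w" using insert.hyps(1) by (simp add: dvd_prodI)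
      then have "g K dvd (u - Const (dual_vec (g K) $ i) * p) - (\<Prod>K\<in>B. g K) * w"
        using u \<open>K \<in> B\<close> by (metis dvd_diff)
      then show ?thesis by (simp add: u'_def algebra_simps)
    qed
    then show ?case by blast
  qed simp
  then show ?thesis using finite_A by blast
qed

section \<open>The decomposition and the radical of the residual\<close>

lemma residual_eq:
  assumes "dual_vec l = a" "\<forall>P\<in>codim2_flats A. axis_form a P (y P)"
  shows "residual (\<Prod>H\<in>A. g H) l = (\<Inter>P\<in>codim2_flats A. component P (y P))"
  using mem_residual_iff_interpolation[OF assms(1)] interpolation_imp_mem_component
    mem_components_imp_interpolation[OF assms(2)] assms(2) by blast

text \<open>A flat is recovered from its ideal, so the radicals differ. For irredundancy, a product
  of elements of the other components is kept outside the prime ideal of \<open>P\<close>.\<close>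

lemma minimal_primary_decomposition_residual:
  assumes "dual_vec l = a" and y: "\<forall>P\<in>codim2_flats A. axis_form a P (y P)"
  shows "minimal_primary_decomposition (residual (\<Prod>H\<in>A. g H) l) (codim2_flats A)
    (\<lambda>P. component P (y P))"
  unfolding minimal_primary_decomposition_def
proof (intro conjI ballI)
  show "inj_on (\<lambda>P. ideal_radical (component P (y P))) (codim2_flats A)"
  proof (rule inj_onI)
    fix P P' assume P: "P \<in> codim2_flats A" "P' \<in> codim2_flats A"
      and "ideal_radical (component P (y P)) = ideal_radical (component P' (y P'))"
    then have eq: "homogeneous_ideal P = homogeneous_ideal P'" using radical_component y by metis
    obtain H K where HK: "H \<in> A" "K \<in> A" "P = H \<inter> K" using P(1) by (rule codim2_flatE)
    have "g J \<in> homogeneous_ideal P" if "J \<in> A" "P \<subseteq> J" for J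
      using vanishes_on_subset[OF that] by (simp add: homogeneous_ideal_eq[OF P(1)])
    then have "g H \<in> homogeneous_ideal P" "g K \<in> homogeneous_ideal P" using HK by auto
    then have "P' \<subseteq> P"
      unfolding eq homogeneous_ideal_eq[OF P(2)] using HK kernel by auto
    then show "P = P'" using flat_subset_imp_eq[OF P(2,1)] by simp
  qed
  fix P assume P: "P \<in> codim2_flats A"
  show "\<not> (\<Inter>P'\<in>codim2_flats A - {P}. component P' (y P')) \<subseteq> component P (y P)"
  proof
    assume sub: "(\<Inter>P'\<in>codim2_flats A - {P}. component P' (y P')) \<subseteq> component P (y P)"
    have "\<exists>q. q \<in> component P' (y P') \<and> q \<notin> homogeneous_ideal P" if P': "P' \<in> codim2_flats A - {P}" for P'
    proof -
      obtain H K where HK: "H \<in> A" "K \<in> A" "P' = H \<inter> K" using P' by (auto elim!: codim2_flatE)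
      \<comment> \<open>Some hyperplane through \<open>P'\<close> does not contain \<open>P\<close>;
        a power of its form is the required element.\<close>
      have "\<not> P \<subseteq> P'" using flat_subset_imp_eq[OF P] P' by auto
      then obtain J where J: "J \<in> A" "\<not> P \<subseteq> J" "P' \<subseteq> J" using HK by blast
      have "g J \<in> homogeneous_ideal P'"
        using J vanishes_on_subset[of J P'] P' by (simp add: homogeneous_ideal_eq)
      then have "g J ^ (flat_mult P' - 1) \<in> component P' (y P')"
        using P' y by (intro power_mem_component) auto
      moreover have "g J ^ (flat_mult P' - 1) \<notin> homogeneous_ideal P"
        using J kernel[of J] by (auto simp: homogeneous_ideal_eq[OF P] peval_power)
      ultimately show ?thesis by blast
    qed
    then obtain q where q: "\<And>P'. P' \<in> codim2_flats A - {P} \<Longrightarrow>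
        q P' \<in> component P' (y P') \<and> q P' \<notin> homogeneous_ideal P" by metis
    have "(\<Prod>P'\<in>codim2_flats A - {P}. q P') \<in> component P'' (y P'')"
      if P'': "P'' \<in> codim2_flats A - {P}" for P''
    proof -
      have "(\<Prod>P'\<in>codim2_flats A - {P}. q P') =
          (\<Prod>P'\<in>codim2_flats A - {P} - {P''}. q P') * q P''"
        using prod.remove[OF _ P''] finite_flats by (simp add: mult.commute)
      then show ?thesis
        using q[OF P''] unfolding component_def by (simp add: ideal.span_scale)
    qed
    then have "(\<Prod>P'\<in>codim2_flats A - {P}. q P') \<in> component P (y P)"
      by (intro subsetD[OF sub] INT_I)
    then have "(\<Prod>P'\<in>codim2_flats A - {P}. q P') \<in> homogeneous_ideal P"
      by (rule subsetD[OF component_subset[OF P bspec[OF y P]]])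
    moreover have "(\<Prod>P'\<in>F. q P') \<notin> homogeneous_ideal P"
      if "finite F" "F \<subseteq> codim2_flats A - {P}" for F
      using that
    proof (induction F rule: finite_induct)
      case (insert P' F)
      then show ?case using q[of P'] homogeneous_ideal_prime[OF P] by auto
    qed (use one_notin_homogeneous_ideal[OF P] in simp)
    ultimately show False using finite_flats by blast
  qed
qed (use residual_eq[OF assms] primary_component y finite_flats in auto)

lemma radical_residual:
  assumes "dual_vec l = a"
  shows "ideal_radical (residual (\<Prod>H\<in>A. g H) l) = (\<Inter>P\<in>codim2_flats A. homogeneous_ideal P)"
proof -
  obtain y where y: "\<forall>P\<in>codim2_flats A. axis_form a P (y P)" using ex_axis_form by metis
  note res = residual_eq[OF assms y]
  show ?thesis
  proof
    show "ideal_radical (residual (\<Prod>H\<in>A. g H) l) \<subseteq> (\<Inter>P\<in>codim2_flats A. homogeneous_ideal P)"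
      using radical_component y unfolding res ideal_radical_def by blast
    show "(\<Inter>P\<in>codim2_flats A. homogeneous_ideal P) \<subseteq> ideal_radical (residual (\<Prod>H\<in>A. g H) l)"
    proof
      fix p assume p: "p \<in> (\<Inter>P\<in>codim2_flats A. homogeneous_ideal P)"
      \<comment> \<open>The number of hyperplanes bounds every multiplicity and serves as the common
        exponent.\<close>
      have "flat_mult P - 1 \<le> card A" for P
        using card_mono[OF finite_A, of "{H \<in> A. P \<subseteq> H}"] by (auto simp: hyperplanes_through_def)
      then have "p ^ card A \<in> residual (\<Prod>H\<in>A. g H) l"
        unfolding res using p y by (auto intro!: power_mem_component)
      then show "p \<in> ideal_radical (residual (\<Prod>H\<in>A. g H) l)" by (auto simp: ideal_radical_def)
    qed
  qed
qed

end

theorem corollary4p8: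
  fixes n :: nat
    and A :: "('a::field_char_0 ^ 'n::finite) set set"
    and h :: "('a ^ 'n) set \<Rightarrow> ('a, 'n) mpoly"
    and f :: "('a, 'n) mpoly"
  assumes "n \<ge> 2"
    and "CARD('n) = n + 1"
    and "hyperplane_arrangement A"
    and "\<forall>H\<in>A. defines_hyperplane (h H) H"
    and "f = arrangement_poly A h"
  shows "\<exists>U. zariski_open_linear_forms U \<and> U \<noteq> {} \<and>
    (\<forall>l\<in>U.
      (\<forall>P\<in>codim2_flats A. proj_hyperplane (dual_join P l)) \<and>
      (\<forall>lP. (\<forall>P\<in>codim2_flats A. defines_hyperplane (lP P) (dual_join P l)) \<longrightarrow>
        minimal_primary_decomposition (residual f l) (codim2_flats A)
          (\<lambda>P. ideal.span
            (insert (lP P) (ideal_power (homogeneous_ideal P) (hyperplanes_through A P - 1))))) \<and>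
      ideal_radical (residual f l) = (\<Inter>P\<in>codim2_flats A. homogeneous_ideal P))"
proof -
  \<comment> \<open>General means that the dual point of \<open>l\<close> lies on no hyperplane of
    \<open>A\<close>, which is the nonvanishing of \<open>f\<close> there.\<close>
  define U where "U = {l \<in> forms 1. peval f (dual_vec l) \<noteq> 0}"
  have fin: "finite A" using assms(3) by (simp add: hyperplane_arrangement_def)
  have h: "h H \<in> forms 1" "h H \<noteq> 0" "z \<in> H \<longleftrightarrow> peval (h H) z = 0" if "H \<in> A" for H z
    using assms(4) that by (auto simp: defines_hyperplane_def)
  have f: "f = (\<Prod>H\<in>A. h H)" using assms(5) by (simp add: arrangement_poly_def)
  have "zariski_open_linear_forms U"
    unfolding zariski_open_linear_forms_def U_def by (rule exI[of _ "{f}"]) auto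
  moreover have "U \<noteq> {}"
  proof -
    have "(\<Prod>H\<in>B. h H) \<noteq> 0" if "finite B" "B \<subseteq> A" for B
      using that
    proof (induction B rule: finite_induct)
      case (insert H B)
      then show ?case using h(2)[of H] mpoly_no_zero_divisors[of "h H" "\<Prod>H\<in>B. h H"] by auto
    qed simp
    from this[OF fin] have "f \<noteq> 0" by (simp add: f)
    then obtain c where "peval f c \<noteq> 0" using peval_eq_0_imp by blast
    then have "linear_form c \<in> U" by (simp add: U_def linear_form_in_forms)
    then show ?thesis by blast
  qed
  moreover have "(\<forall>P\<in>codim2_flats A. proj_hyperplane (dual_join P l)) \<and>
      (\<forall>lP. (\<forall>P\<in>codim2_flats A. defines_hyperplane (lP P) (dual_join P l)) \<longrightarrow>
        minimal_primary_decomposition (residual f l) (codim2_flats A)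
          (\<lambda>P. ideal.span
            (insert (lP P) (ideal_power (homogeneous_ideal P) (hyperplanes_through A P - 1))))) \<and>
      ideal_radical (residual f l) = (\<Inter>P\<in>codim2_flats A. homogeneous_ideal P)" if l: "l \<in> U" for l
  proof -
    define a where "a = dual_vec l"
    have nz: "peval (h H) a \<noteq> 0" if "H \<in> A" for H
      using l fin that by (auto simp: U_def f peval_prod a_def)
    \<comment> \<open>Division by the nonzero value at \<open>a\<close> normalizes the forms and
      changes their product only by a nonzero constant.\<close>
    define g where "g H = Const (1 / peval (h H) a) * h H" for H
    interpret normalized_arrangement A g a
      by unfold_locales (simp_all add: fin g_def h forms_1_scale peval_mult nz)
    have "(\<Prod>H\<in>A. g H) = Const (\<Prod>H\<in>A. 1 / peval (h H) a) * f"
      by (simp only: f g_def prod.distrib prod_Const)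
    then have res: "residual (\<Prod>H\<in>A. g H) l = residual f l"
      using residual_Const_mult[of "\<Prod>H\<in>A. 1 / peval (h H) a" f l] fin nz by simp
    have join: "dual_join P l = vec.span (insert a P)" for P
      by (simp add: dual_join_def a_def)
    have "minimal_primary_decomposition (residual f l) (codim2_flats A)
          (\<lambda>P. ideal.span
            (insert (lP P) (ideal_power (homogeneous_ideal P) (hyperplanes_through A P - 1))))"
      if lP: "\<forall>P\<in>codim2_flats A. defines_hyperplane (lP P) (dual_join P l)" for lP
    proof -
      have "\<forall>P\<in>codim2_flats A. axis_form a P (lP P)"
        using lP by (auto intro!: axis_formI simp: defines_hyperplane_def join)
      from minimal_primary_decomposition_residual[OF a_def[symmetric] this]
      show ?thesis unfolding res component_def .
    qed
    then show ?thesis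
      using proj_hyperplane_span radical_residual[OF a_def[symmetric]] unfolding res join by blast
  qed
  ultimately show ?thesis by blast
qed

end
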